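(* For every $p\in(0.42,0.5)$ there exists $\gamma>0$ such that, as $t\to\infty$, \[ c_{t,t}\le \exp\left(\left(\frac{(4\log(1-p)-\log p)\,\log p}{8\log(1-p)}-\gamma\right)t^2+o(t^2)\right). \]
   Context: For integers $s,t\ge 1$, $c_{s,t}$ denotes the infimum, over all finite graphs $G$ containing no copy of the complete graph $K_t$, of the probability that $s$ independent uniformly random vertices $v_1,\dots,v_s\in V(G)$ (chosen with replacement, so repetitions are allowed) form an independent set in $G$, i.e. no two of them are adjacent. Here $\log$ is the natural logarithm. *)

theory Defs
  imports "HOL-Analysis.Analysis" "HOL-Library.FuncSet" "HOL-Library.Landau_Symbols"
begin

text \<open>A finite simple graph on vertex set {..<n}, given by a symmetric irreflexive
  edge relation E (edges outside the vertex set are irrelevant).\<close>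
definition simple_graph :: "(nat \<Rightarrow> nat \<Rightarrow> bool) \<Rightarrow> bool" where
  "simple_graph E \<longleftrightarrow> (\<forall>u v. E u v \<longrightarrow> E v u) \<and> (\<forall>v. \<not> E v v)"

definition contains_clique :: "nat \<Rightarrow> (nat \<Rightarrow> nat \<Rightarrow> bool) \<Rightarrow> nat \<Rightarrow> bool" where
  "contains_clique n E t \<longleftrightarrow>
     (\<exists>S. S \<subseteq> {..<n} \<and> card S = t \<and> (\<forall>u\<in>S. \<forall>v\<in>S. u \<noteq> v \<longrightarrow> E u v))"

definition indep_prob :: "nat \<Rightarrow> (nat \<Rightarrow> nat \<Rightarrow> bool) \<Rightarrow> nat \<Rightarrow> real" where
  "indep_prob n E s =
     real (card {f \<in> {..<s} \<rightarrow>\<^sub>E {..<n}. \<forall>i<s. \<forall>j<s. \<not> E (f i) (f j)}) / real n ^ s"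

definition c_const :: "nat \<Rightarrow> nat \<Rightarrow> real" where
  "c_const s t = Inf {indep_prob n E s | n E. n \<ge> 1 \<and> simple_graph E \<and> \<not> contains_clique n E t}"

end

theory Submission
  imports Defs "HOL-Real_Asymp.Real_Asymp"
begin

text \<open>
  Give every vertex \<open>v\<close> of a graph on about \<open>exp (a t)\<close> vertices an independent uniform feature
  \<open>x\<^sub>v \<in> {-1, 1}\<^bsup>t\<^sup>2\<^esup>\<close> and join \<open>u\<close> and \<open>v\<close> with probability \<open>p exp (- s K - s\<^sup>2 / 2)\<close>, capped slightly
  above \<open>p\<close>, where \<open>K = \<langle>x\<^sub>u, x\<^sub>v\<rangle> / t\<close> is roughly standard normal and \<open>s\<close> is a small constant. The edge
  density is still \<open>p\<close>, but triangles of features are correlated: a \<open>t\<close>-set is a clique with probability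
  \<open>exp (t\<^sup>2 (ln p / 2 - s\<^sup>3 / 6 + O(s\<^sup>4)))\<close>, while a \<open>y t\<close>-set is independent with probability at most
  \<open>exp (t\<^sup>2 (y\<^sup>2 ln (1 - p) / 2 + (s \<rho> y)\<^sup>3 / 6 + O(s\<^sup>4)))\<close> for any \<open>\<rho> > p / (1 - p)\<close>. The first estimate
  allows a larger \<open>a\<close>. The typical independent \<open>t\<close>-tuple has \<open>\<kappa> t\<close> distinct entries with
  \<open>\<kappa> = ln p / (2 ln (1 - p))\<close>, so relative to the binomial random graph of density \<open>p\<close> the exponent changes by
  \<open>s\<^sup>3 / 6 ((\<kappa> \<rho>)\<^sup>3 - (1 - \<kappa>))\<close> up to \<open>O(s\<^sup>4)\<close>, which is negative for suitable \<open>\<rho>\<close>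
  since \<open>(\<kappa> p / (1 - p))\<^sup>3 < 1 - \<kappa>\<close> when \<open>p > 0.42\<close>.

  For the independent sets the coordinates of all features are revealed one by one. If \<open>V\<^sub>m\<close> denotes the
  conditional non-edge probability with \<open>m\<close> coordinates hidden, then \<open>V\<^sub>m (K \<plusminus> h) = V\<^sub>m\<^sub>+\<^sub>1 (K) (1 \<plusminus> \<alpha>)\<close> holds exactly,
  with \<open>\<alpha>\<close> controlled by the Lipschitz constant of \<open>ln V\<^sub>0\<close>, and the average over signs of
  \<open>\<Prod> (1 + \<alpha>\<^sub>i\<^sub>j x\<^sub>i x\<^sub>j)\<close> is monotone in the absolute values of the \<open>\<alpha>\<^sub>i\<^sub>j\<close>.
\<close>

subsection \<open>Random graphs with vertex features\<close>

definition pairs :: "nat set \<Rightarrow> (nat \<times> nat) set" where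
  "pairs S = {(i, j). i \<in> S \<and> j \<in> S \<and> i < j}"

lemma finite_pairs [simp, intro]: "finite S \<Longrightarrow> finite (pairs S)"
  by (rule finite_subset[of _ "S \<times> S"]) (auto simp: pairs_def)

lemma pairs_lessThan_Suc: "pairs {..<Suc k} = pairs {..<k} \<union> (\<lambda>i. (i, k)) ` {..<k}"
  by (auto simp: pairs_def less_Suc_eq)

lemma pairs_lessThan_disjoint: "pairs {..<k} \<inter> (\<lambda>i. (i, k)) ` {..<k} = {}"
  by (auto simp: pairs_def)

lemma sum_pairs_lessThan_Suc:
  "sum f (pairs {..<Suc k}) = sum f (pairs {..<k}) + (\<Sum>i<k. f (i, k))"
proof -
  have "sum f ((\<lambda>i. (i, k)) ` {..<k}) = (\<Sum>i<k. f (i, k))"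
    by (subst sum.reindex) (auto simp: inj_on_def)
  then show ?thesis
    unfolding pairs_lessThan_Suc
    by (subst sum.union_disjoint) (auto simp: pairs_lessThan_disjoint)
qed

lemma card_pairs_lessThan: "real (card (pairs {..<k})) = real k * (real k - 1) / 2"
proof (induction k)
  case 0
  then show ?case by (simp add: pairs_def)
next
  case (Suc k)
  have "card (pairs {..<Suc k}) = card (pairs {..<k}) + k"
    using sum_pairs_lessThan_Suc[of "\<lambda>_. 1::nat" k] by simp
  with Suc show ?case by (simp add: field_simps)
qed

lemma sum_PiE_insert:
  assumes "a \<notin> A"
  shows "(\<Sum>x\<in>PiE (insert a A) B. F x) = (\<Sum>b\<in>B a. \<Sum>x\<in>PiE A B. F (x(a := b)))"
proof -
  have "(\<Sum>x\<in>PiE (insert a A) B. F x) = (\<Sum>(b, x)\<in>B a \<times> PiE A B. F (x(a := b)))"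
    unfolding PiE_insert_eq
    by (subst sum.reindex[OF inj_combinator[OF assms]]) (auto simp: case_prod_unfold intro!: sum.cong)
  then show ?thesis by (simp add: sum.cartesian_product)
qed

lemma sum_PiE_ignore_coords:
  fixes F :: "('a \<Rightarrow> 'b) \<Rightarrow> real"
  assumes "finite B" and "B \<inter> S = {}" and "\<And>x a b. a \<notin> S \<Longrightarrow> F (x(a := b)) = F x"
  shows "(\<Sum>x\<in>PiE (B \<union> S) (\<lambda>_. \<Omega>). F x) = real (card \<Omega>) ^ card B * (\<Sum>x\<in>PiE S (\<lambda>_. \<Omega>). F x)"
  using assms(1,2)
proof (induction B rule: finite_induct)
  case (insert a B)
  have "(\<Sum>x\<in>PiE (insert a B \<union> S) (\<lambda>_. \<Omega>). F x) =
      (\<Sum>b\<in>\<Omega>. \<Sum>x\<in>PiE (B \<union> S) (\<lambda>_. \<Omega>). F (x(a := b)))"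
    unfolding Un_insert_left by (rule sum_PiE_insert) (use insert in auto)
  also have "\<dots> = (\<Sum>b\<in>\<Omega>. \<Sum>x\<in>PiE (B \<union> S) (\<lambda>_. \<Omega>). F x)"
    using insert.prems by (simp add: assms(3))
  finally show ?case using insert by (simp add: mult_ac)
qed simp

text \<open>Expected product of \<open>w\<close> over all pairs of \<open>k\<close> independent
  uniform features: the clique probability of \<open>k\<close> vertices if \<open>w\<close> is the
  connection probability, their independence probability if \<open>w\<close> is its
  complement.\<close>

definition pair_avg :: "'a set \<Rightarrow> ('a \<Rightarrow> 'a \<Rightarrow> real) \<Rightarrow> nat \<Rightarrow> real" where
  "pair_avg \<Omega> w k =
     (\<Sum>y\<in>PiE {..<k} (\<lambda>_. \<Omega>). \<Prod>(i, j)\<in>pairs {..<k}. w (y i) (y j)) / real (card \<Omega>) ^ k"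

lemma pair_avg_nonneg: "(\<And>x y. 0 \<le> w x y) \<Longrightarrow> 0 \<le> pair_avg \<Omega> w k"
  unfolding pair_avg_def by (auto intro!: divide_nonneg_nonneg sum_nonneg prod_nonneg)

text \<open>Coordinates outside \<open>S\<close> are free and contribute powers of
  \<open>card \<Omega>\<close>. The increasing enumeration of \<open>S\<close> maps
  \<open>pairs {..<card S}\<close> onto \<open>pairs S\<close> and keeps the order of the arguments
  of \<open>w\<close>, which may be asymmetric.\<close>

lemma sum_PiE_pairs:
  assumes "finite N" and "S \<subseteq> N" and "finite \<Omega>" and "\<Omega> \<noteq> {}"
  shows "(\<Sum>x\<in>PiE N (\<lambda>_. \<Omega>). \<Prod>(i, j)\<in>pairs S. w (x i) (x j)) =
      real (card \<Omega>) ^ card N * pair_avg \<Omega> w (card S)"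
proof -
  have fS: "finite S" using assms finite_subset by blast
  let ?F = "\<lambda>x. \<Prod>(i, j)\<in>pairs S. w (x i) (x j)"
  obtain h where h: "bij_betw h {..<card S} S" and m: "strict_mono_on {..<card S} h"
    using ex_bij_betw_strict_mono_card[OF fS] by blast
  have hS: "h i \<in> S" if "i < card S" for i
    using bij_betwE[OF h] that by simp
  define g where "g = inv_into {..<card S} h"
  have g: "g i < card S" "h (g i) = i" if "i \<in> S" for i
    using bij_betw_inv_into_right[OF h that] bij_betwE[OF bij_betw_inv_into[OF h]] that
    by (auto simp: g_def)
  have gh: "g (h i) = i" if "i < card S" for i
    using bij_betw_inv_into_left[OF h] that by (simp add: g_def)
  have "(\<Sum>x\<in>PiE N (\<lambda>_. \<Omega>). ?F x) = (\<Sum>x\<in>PiE ((N - S) \<union> S) (\<lambda>_. \<Omega>). ?F x)"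
    using assms by (simp add: Un_absorb2)
  also have "\<dots> = real (card \<Omega>) ^ card (N - S) * (\<Sum>x\<in>PiE S (\<lambda>_. \<Omega>). ?F x)"
  proof (rule sum_PiE_ignore_coords)
    fix x :: "nat \<Rightarrow> 'a" and a b assume "a \<notin> S"
    then show "?F (x(a := b)) = ?F x"
      by (intro prod.cong refl) (auto simp: pairs_def)
  qed (use assms in auto)
  also have "(\<Sum>x\<in>PiE S (\<lambda>_. \<Omega>). ?F x) =
      (\<Sum>y\<in>PiE {..<card S} (\<lambda>_. \<Omega>). \<Prod>(i, j)\<in>pairs {..<card S}. w (y i) (y j))"
  proof (rule sum.reindex_bij_witness[where i = "\<lambda>y. restrict (\<lambda>a. y (g a)) S"
        and j = "\<lambda>x. restrict (\<lambda>i. x (h i)) {..<card S}"])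
    fix x assume x: "x \<in> PiE S (\<lambda>_. \<Omega>)"
    show "restrict (\<lambda>a. restrict (\<lambda>i. x (h i)) {..<card S} (g a)) S = x"
    proof
      fix a show "restrict (\<lambda>a. restrict (\<lambda>i. x (h i)) {..<card S} (g a)) S a = x a"
        using g[of a] PiE_arb[OF x, of a] by (cases "a \<in> S") simp_all
    qed
    show "restrict (\<lambda>i. x (h i)) {..<card S} \<in> PiE {..<card S} (\<lambda>_. \<Omega>)"
      using x hS by (simp add: PiE_iff)
    have bij: "bij_betw (map_prod h h) (pairs {..<card S}) (pairs S)"
      unfolding bij_betw_def
    proof (intro conjI)
      show "inj_on (map_prod h h) (pairs {..<card S})"
        using h by (auto simp: bij_betw_def inj_on_def pairs_def)
      show "map_prod h h ` pairs {..<card S} = pairs S"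
      proof (intro equalityI subsetI)
        fix z assume "z \<in> map_prod h h ` pairs {..<card S}"
        then show "z \<in> pairs S"
          using h m by (auto simp: pairs_def bij_betw_def strict_mono_on_def)
      next
        fix z assume "z \<in> pairs S"
        then obtain a b where ab: "z = (a, b)" "a \<in> S" "b \<in> S" "a < b"
          by (auto simp: pairs_def)
        have "g a < g b"
          using m ab g[of a] g[of b]
          by (metis lessThan_iff linorder_neqE_nat order_less_asym strict_mono_on_def)
        then have "(g a, g b) \<in> pairs {..<card S}" using ab g by (simp add: pairs_def)
        moreover have "z = map_prod h h (g a, g b)" using ab g by simp
        ultimately show "z \<in> map_prod h h ` pairs {..<card S}" by blast
      qed
    qed
    have "(\<Prod>(i, j)\<in>pairs S. w (x i) (x j)) = (\<Prod>e\<in>pairs {..<card S}. case map_prod h h e of (i, j) \<Rightarrow> w (x i) (x j))"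
      by (rule prod.reindex_bij_betw[OF bij, symmetric])
    also have "\<dots> = (\<Prod>(i, j)\<in>pairs {..<card S}. w (restrict (\<lambda>i. x (h i)) {..<card S} i) (restrict (\<lambda>i. x (h i)) {..<card S} j))"
      by (rule prod.cong) (auto simp: pairs_def)
    finally show "(\<Prod>(i, j)\<in>pairs {..<card S}. w (restrict (\<lambda>i. x (h i)) {..<card S} i) (restrict (\<lambda>i. x (h i)) {..<card S} j)) =
        (\<Prod>(i, j)\<in>pairs S. w (x i) (x j))" by simp
  next
    fix y assume y: "y \<in> PiE {..<card S} (\<lambda>_. \<Omega>)"
    show "restrict (\<lambda>i. restrict (\<lambda>a. y (g a)) S (h i)) {..<card S} = y"
    proof
      fix i show "restrict (\<lambda>i. restrict (\<lambda>a. y (g a)) S (h i)) {..<card S} i = y i"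
        using gh[of i] hS[of i] PiE_arb[OF y, of i] by (cases "i < card S") simp_all
    qed
    show "restrict (\<lambda>a. y (g a)) S \<in> PiE S (\<lambda>_. \<Omega>)"
      using y g by (simp add: PiE_iff)
  qed
  also have "\<dots> = real (card \<Omega>) ^ card S * pair_avg \<Omega> w (card S)"
    using assms by (simp add: pair_avg_def)
  also have "real (card \<Omega>) ^ card (N - S) * \<dots> = real (card \<Omega>) ^ card N * pair_avg \<Omega> w (card S)"
    using assms fS card_mono[OF assms(1,2)]
    by (simp add: card_Diff_subset mult.assoc[symmetric] power_add[symmetric])
  finally show ?thesis .
qed

section \<open>Independent random edges and the first-moment method\<close>

definition bernoulli_weight :: "'e set \<Rightarrow> ('e \<Rightarrow> real) \<Rightarrow> 'e set \<Rightarrow> real" where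
  "bernoulli_weight P w G = (\<Prod>e\<in>G. w e) * (\<Prod>e\<in>P - G. 1 - w e)"

text \<open>Replacing \<open>1 - w e\<close> by 0 on \<open>S\<close> removes the terms with
  \<open>G\<close> not containing \<open>S\<close>. The sum over \<open>Pow P\<close> then factors
  into two-term sums, equal to \<open>w e\<close> on \<open>S\<close> and to 1 elsewhere.\<close>

lemma bernoulli_weight_superset:
  assumes "finite P" and "S \<subseteq> P"
  shows "(\<Sum>G\<in>Pow P. bernoulli_weight P w G * of_bool (S \<subseteq> G)) = (\<Prod>e\<in>S. w e)"
proof -
  have "(\<Sum>G\<in>Pow P. bernoulli_weight P w G * of_bool (S \<subseteq> G)) =
      (\<Sum>G\<in>Pow P. (\<Prod>e\<in>G. w e) * (\<Prod>e\<in>P - G. if e \<in> S then 0 else 1 - w e))"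
  proof (rule sum.cong)
    fix G assume "G \<in> Pow P"
    show "bernoulli_weight P w G * of_bool (S \<subseteq> G) =
        (\<Prod>e\<in>G. w e) * (\<Prod>e\<in>P - G. if e \<in> S then 0 else 1 - w e)"
    proof (cases "S \<subseteq> G")
      case True
      then have "(\<Prod>e\<in>P - G. if e \<in> S then 0 else 1 - w e) = (\<Prod>e\<in>P - G. 1 - w e)"
        by (intro prod.cong) auto
      with True show ?thesis by (simp add: bernoulli_weight_def)
    next
      case False
      then have "(\<Prod>e\<in>P - G. if e \<in> S then 0 else 1 - w e) = 0"
        using assms by (intro prod_zero) auto
      with False show ?thesis by simp
    qed
  qed simp
  also have "\<dots> = (\<Prod>e\<in>P. w e + (if e \<in> S then 0 else 1 - w e))"
    by (rule prod_add[OF assms(1), symmetric])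
  also have "\<dots> = (\<Prod>e\<in>P. if e \<in> S then w e else 1)"
    by (rule prod.cong) auto
  also have "\<dots> = (\<Prod>e\<in>S. w e)"
    using assms by (simp add: prod.If_cases Int_absorb1)
  finally show ?thesis .
qed

lemma bernoulli_weight_compl:
  assumes "finite P" and "G \<subseteq> P"
  shows "bernoulli_weight P w (P - G) = bernoulli_weight P (\<lambda>e. 1 - w e) G"
  using assms by (simp add: bernoulli_weight_def double_diff mult.commute)

lemma bernoulli_weight_disjoint:
  assumes "finite P" and "S \<subseteq> P"
  shows "(\<Sum>G\<in>Pow P. bernoulli_weight P w G * of_bool (S \<inter> G = {})) = (\<Prod>e\<in>S. 1 - w e)"
proof -
  have "(\<Sum>G\<in>Pow P. bernoulli_weight P w G * of_bool (S \<inter> G = {})) =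
      (\<Sum>G\<in>Pow P. bernoulli_weight P (\<lambda>e. 1 - w e) G * of_bool (S \<subseteq> G))"
  proof (rule sum.reindex_bij_witness[of _ "\<lambda>G. P - G" "\<lambda>G. P - G"])
    fix G assume G: "G \<in> Pow P"
    then have "(S \<inter> G = {}) = (S \<subseteq> P - G)" using assms by auto
    moreover have "bernoulli_weight P (\<lambda>e. 1 - w e) (P - G) = bernoulli_weight P w G"
      using bernoulli_weight_compl[of P G "\<lambda>e. 1 - w e"] assms G by simp
    ultimately show "bernoulli_weight P (\<lambda>e. 1 - w e) (P - G) * of_bool (S \<subseteq> P - G) =
        bernoulli_weight P w G * of_bool (S \<inter> G = {})" by simp
  qed auto
  also have "\<dots> = (\<Prod>e\<in>S. 1 - w e)"
    by (rule bernoulli_weight_superset[OF assms])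
  finally show ?thesis .
qed

text \<open>Choose the image, one of at most \<open>n ^ k\<close> sets, then one of
  \<open>k ^ s\<close> maps into it.\<close>

lemma card_funs_image_card_le:
  "card {f \<in> PiE {..<s} (\<lambda>_. {..<n}). card (f ` {..<s}) = k} \<le> n ^ k * k ^ s"
proof (cases "k \<le> n")
  case True
  let ?T = "{T. T \<subseteq> {..<n} \<and> card T = k}"
  have fin: "finite ?T" by simp
  have sub: "{f \<in> PiE {..<s} (\<lambda>_. {..<n}). card (f ` {..<s}) = k} \<subseteq> (\<Union>T\<in>?T. PiE {..<s} (\<lambda>_. T))"
  proof
    fix f assume f: "f \<in> {f \<in> PiE {..<s} (\<lambda>_. {..<n}). card (f ` {..<s}) = k}"
    then have "f ` {..<s} \<in> ?T" "f \<in> PiE {..<s} (\<lambda>_. f ` {..<s})"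
      by (auto simp: PiE_iff)
    then show "f \<in> (\<Union>T\<in>?T. PiE {..<s} (\<lambda>_. T))" by blast
  qed
  have fin2: "finite (PiE {..<s} (\<lambda>_. T))" if "T \<in> ?T" for T
    using that by (intro finite_PiE) (auto intro: finite_subset)
  have "card {f \<in> PiE {..<s} (\<lambda>_. {..<n}). card (f ` {..<s}) = k} \<le> card (\<Union>T\<in>?T. PiE {..<s} (\<lambda>_. T))"
    by (rule card_mono[OF _ sub]) (use fin fin2 in blast)
  also have "\<dots> \<le> (\<Sum>T\<in>?T. card (PiE {..<s} (\<lambda>_. T)))"
    by (rule card_UN_le[OF fin])
  also have "\<dots> = (\<Sum>T\<in>?T. k ^ s)"
    by (rule sum.cong) (auto simp: card_PiE)
  also have "\<dots> = (n choose k) * k ^ s"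
    using n_subsets[of "{..<n}" k] by simp
  also have "\<dots> \<le> n ^ k * k ^ s"
    using binomial_le_pow[OF True] by simp
  finally show ?thesis .
next
  case False
  have "card (f ` {..<s}) \<noteq> k" if "f \<in> PiE {..<s} (\<lambda>_. {..<n})" for f
  proof -
    have "card (f ` {..<s}) \<le> card {..<n}"
      using that by (intro card_mono) auto
    then show ?thesis using False by simp
  qed
  then have "{f \<in> PiE {..<s} (\<lambda>_. {..<n}). card (f ` {..<s}) = k} = {}" by auto
  then show ?thesis by (simp only: card.empty le0)
qed

definition edge_rel :: "(nat \<times> nat) set \<Rightarrow> nat \<Rightarrow> nat \<Rightarrow> bool" where
  "edge_rel G u v \<longleftrightarrow> (u, v) \<in> G \<or> (v, u) \<in> G"

text \<open>First-moment argument. The expected number of \<open>t\<close>-cliques is below 1/2.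
  There are at most \<open>n ^ k * s ^ s\<close> tuples with \<open>k\<close> distinct entries, each
  independent with probability \<open>pair_avg\<close> at \<open>k\<close>; summing over
  \<open>k\<close> bounds the expected number of independent tuples by
  \<open>(s + 1) * s ^ s * M\<close>.\<close>

lemma random_kernel_graph:
  fixes W :: "'a \<Rightarrow> 'a \<Rightarrow> real"
  assumes \<Omega>: "finite \<Omega>" "\<Omega> \<noteq> {}"
    and W: "\<And>x y. 0 \<le> W x y" "\<And>x y. W x y \<le> 1"
    and clique: "real n ^ t * pair_avg \<Omega> W t < 1 / 2"
    and indep: "\<And>k. k \<le> s \<Longrightarrow> real n ^ k * pair_avg \<Omega> (\<lambda>x y. 1 - W x y) k \<le> M"
    and M: "0 < M"
  obtains E where "simple_graph E" "\<not> contains_clique n E t"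
    "indep_prob n E s \<le> 2 * (real s + 1) * real s ^ s * M / real n ^ s"
proof -
  define P where "P = pairs {..<n}"
  define X where "X = PiE {..<n} (\<lambda>_. \<Omega>)"
  define wt where "wt x G = bernoulli_weight P (\<lambda>(i, j). W (x i) (x j)) G" for x G
  define \<S> where "\<S> = {S. S \<subseteq> {..<n} \<and> card S = t}"
  define \<F> where "\<F> = PiE {..<s} (\<lambda>_. {..<n})"
  define Cl where "Cl G = (\<Sum>S\<in>\<S>. of_bool (pairs S \<subseteq> G) :: real)" for G
  define In where "In G = (\<Sum>f\<in>\<F>. of_bool (pairs (f ` {..<s}) \<inter> G = {}) :: real)" for G
  have finP: "finite P" by (simp add: P_def)
  have finX: "finite X" unfolding X_def using \<Omega> by (intro finite_PiE) auto
  have fin\<S>: "finite \<S>" by (simp add: \<S>_def)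
  have fin\<F>: "finite \<F>" unfolding \<F>_def by (intro finite_PiE) auto
  have cX: "card X = card \<Omega> ^ n" by (simp add: X_def card_PiE)
  have c\<Omega>: "real (card \<Omega>) > 0" using \<Omega> by (simp add: card_gt_0_iff)
  have cXpos: "real (card X) > 0" using c\<Omega> by (simp add: cX)
  have wt0: "wt x G \<ge> 0" for x G
    unfolding wt_def bernoulli_weight_def using W by (auto intro!: mult_nonneg_nonneg prod_nonneg)
  have wt1: "(\<Sum>G\<in>Pow P. wt x G) = 1" for x
    using bernoulli_weight_superset[of P "{}" "\<lambda>(i, j). W (x i) (x j)"] finP by (simp add: wt_def)
  have pS: "pairs S \<subseteq> P" if "S \<subseteq> {..<n}" for S
    using that by (auto simp: pairs_def P_def)
  have image: "f ` {..<s} \<subseteq> {..<n}" if "f \<in> \<F>" for f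
    using that by (auto simp: \<F>_def)
  have ECl: "(\<Sum>x\<in>X. \<Sum>G\<in>Pow P. wt x G * Cl G) = real (card X) * (real (card \<S>) * pair_avg \<Omega> W t)"
  proof -
    have "(\<Sum>x\<in>X. \<Sum>G\<in>Pow P. wt x G * Cl G) =
        (\<Sum>x\<in>X. \<Sum>S\<in>\<S>. \<Sum>G\<in>Pow P. wt x G * of_bool (pairs S \<subseteq> G))"
      unfolding Cl_def sum_distrib_left by (intro sum.cong refl sum.swap)
    also have "\<dots> = (\<Sum>x\<in>X. \<Sum>S\<in>\<S>. \<Prod>(i, j)\<in>pairs S. W (x i) (x j))"
      unfolding wt_def by (intro sum.cong refl bernoulli_weight_superset finP pS) (auto simp: \<S>_def)
    also have "\<dots> = (\<Sum>S\<in>\<S>. \<Sum>x\<in>X. \<Prod>(i, j)\<in>pairs S. W (x i) (x j))"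
      by (rule sum.swap)
    also have "\<dots> = (\<Sum>S\<in>\<S>. real (card \<Omega>) ^ n * pair_avg \<Omega> W t)"
    proof (rule sum.cong)
      fix S assume S: "S \<in> \<S>"
      show "(\<Sum>x\<in>X. \<Prod>(i, j)\<in>pairs S. W (x i) (x j)) = real (card \<Omega>) ^ n * pair_avg \<Omega> W t"
        using sum_PiE_pairs[of "{..<n}" S \<Omega> W] S \<Omega> by (simp add: X_def \<S>_def)
    qed simp
    finally show ?thesis by (simp add: cX)
  qed
  have EIn: "(\<Sum>x\<in>X. \<Sum>G\<in>Pow P. wt x G * In G) =
      real (card X) * (\<Sum>f\<in>\<F>. pair_avg \<Omega> (\<lambda>x y. 1 - W x y) (card (f ` {..<s})))"
  proof -
    have "(\<Sum>x\<in>X. \<Sum>G\<in>Pow P. wt x G * In G) =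
        (\<Sum>x\<in>X. \<Sum>f\<in>\<F>. \<Sum>G\<in>Pow P. wt x G * of_bool (pairs (f ` {..<s}) \<inter> G = {}))"
      unfolding In_def sum_distrib_left by (intro sum.cong refl sum.swap)
    also have "\<dots> = (\<Sum>x\<in>X. \<Sum>f\<in>\<F>. \<Prod>(i, j)\<in>pairs (f ` {..<s}). 1 - W (x i) (x j))"
    proof (intro sum.cong refl)
      fix x f assume "f \<in> \<F>"
      then have "(\<Sum>G\<in>Pow P. wt x G * of_bool (pairs (f ` {..<s}) \<inter> G = {})) =
          (\<Prod>e\<in>pairs (f ` {..<s}). 1 - (case e of (i, j) \<Rightarrow> W (x i) (x j)))"
        unfolding wt_def by (intro bernoulli_weight_disjoint finP pS image)
      then show "(\<Sum>G\<in>Pow P. wt x G * of_bool (pairs (f ` {..<s}) \<inter> G = {})) =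
          (\<Prod>(i, j)\<in>pairs (f ` {..<s}). 1 - W (x i) (x j))"
        by (simp add: case_prod_unfold)
    qed
    also have "\<dots> = (\<Sum>f\<in>\<F>. \<Sum>x\<in>X. \<Prod>(i, j)\<in>pairs (f ` {..<s}). 1 - W (x i) (x j))"
      by (rule sum.swap)
    also have "\<dots> = (\<Sum>f\<in>\<F>. real (card \<Omega>) ^ n * pair_avg \<Omega> (\<lambda>x y. 1 - W x y) (card (f ` {..<s})))"
    proof (rule sum.cong)
      fix f assume f: "f \<in> \<F>"
      show "(\<Sum>x\<in>X. \<Prod>(i, j)\<in>pairs (f ` {..<s}). 1 - W (x i) (x j)) =
          real (card \<Omega>) ^ n * pair_avg \<Omega> (\<lambda>x y. 1 - W x y) (card (f ` {..<s}))"
        using sum_PiE_pairs[of "{..<n}" "f ` {..<s}" \<Omega> "\<lambda>x y. 1 - W x y"] image[OF f] \<Omega>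
        by (simp add: X_def)
    qed simp
    finally show ?thesis by (simp add: cX sum_distrib_left)
  qed
  have card\<S>: "real (card \<S>) \<le> real n ^ t"
  proof (cases "t \<le> n")
    case True
    then show ?thesis
      using n_subsets[of "{..<n}" t] binomial_le_pow[OF True]
      unfolding \<S>_def by (metis card_lessThan finite_lessThan of_nat_le_iff of_nat_power)
  next
    case False
    then show ?thesis
      using n_subsets[of "{..<n}" t] unfolding \<S>_def
      by (metis binomial_eq_0 card_lessThan finite_lessThan not_le of_nat_0 of_nat_0_le_iff zero_le_power)
  qed
  have cl: "real (card \<S>) * pair_avg \<Omega> W t < 1 / 2"
    using mult_right_mono[OF card\<S> pair_avg_nonneg[of W \<Omega> t]] clique W by simp
  define B where "B = (real s + 1) * real s ^ s * M"
  have Bpos: "B > 0" using M by (cases "s = 0") (auto simp: B_def)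
  have inB: "(\<Sum>f\<in>\<F>. pair_avg \<Omega> (\<lambda>x y. 1 - W x y) (card (f ` {..<s}))) \<le> B"
  proof -
    let ?a = "pair_avg \<Omega> (\<lambda>x y. 1 - W x y)"
    have a0: "?a k \<ge> 0" for k by (rule pair_avg_nonneg) (use W in simp)
    have "(\<Sum>f\<in>\<F>. ?a (card (f ` {..<s}))) = (\<Sum>k\<in>{..s}. \<Sum>f\<in>{f \<in> \<F>. card (f ` {..<s}) = k}. ?a (card (f ` {..<s})))"
    proof (rule sum.group[symmetric, OF fin\<F>])
      show "(\<lambda>f. card (f ` {..<s})) ` \<F> \<subseteq> {..s}"
        using card_image_le[of "{..<s}"] by auto
    qed simp
    also have "\<dots> = (\<Sum>k\<in>{..s}. real (card {f \<in> \<F>. card (f ` {..<s}) = k}) * ?a k)"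
      by (intro sum.cong) auto
    also have "\<dots> \<le> (\<Sum>k\<in>{..s}. real s ^ s * M)"
    proof (rule sum_mono)
      fix k assume "k \<in> {..s}"
      then have k: "k \<le> s" by simp
      have "real (card {f \<in> \<F>. card (f ` {..<s}) = k}) \<le> real (n ^ k * k ^ s)"
        unfolding \<F>_def of_nat_le_iff by (rule card_funs_image_card_le)
      also have "\<dots> \<le> real s ^ s * real n ^ k"
        using k by (simp add: power_mono mult_left_mono mult.commute[of "real s ^ s"])
      finally have "real (card {f \<in> \<F>. card (f ` {..<s}) = k}) * ?a k \<le> real s ^ s * real n ^ k * ?a k"
        using a0 by (rule mult_right_mono)
      also have "\<dots> \<le> real s ^ s * M"
        using indep[OF k] by (simp add: mult.assoc mult_left_mono)
      finally show "real (card {f \<in> \<F>. card (f ` {..<s}) = k}) * ?a k \<le> real s ^ s * M" .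
    qed
    also have "\<dots> = B" by (simp add: B_def mult.assoc)
    finally show ?thesis .
  qed
  \<comment> \<open>The combined quantity has mean below \<open>1 / 2 + 1 / 2\<close>. Where it is
    below 1 there is no clique, since \<open>Cl G\<close> is a count, and there are at most
    \<open>2 * B\<close> independent tuples.\<close>
  have "\<exists>x\<in>X. \<exists>G\<in>Pow P. Cl G + In G / (2 * B) < 1"
  proof (rule ccontr)
    assume "\<not> ?thesis"
    then have ge: "1 \<le> Cl G + In G / (2 * B)" if "x \<in> X" "G \<in> Pow P" for x G
      using that by (auto simp: not_less)
    have "real (card X) = (\<Sum>x\<in>X. \<Sum>G\<in>Pow P. wt x G * 1)"
      by (simp add: wt1)
    also have "\<dots> \<le> (\<Sum>x\<in>X. \<Sum>G\<in>Pow P. wt x G * (Cl G + In G / (2 * B)))"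
      by (intro sum_mono mult_left_mono ge wt0)
    also have "\<dots> = (\<Sum>x\<in>X. \<Sum>G\<in>Pow P. wt x G * Cl G) + (\<Sum>x\<in>X. \<Sum>G\<in>Pow P. wt x G * In G) / (2 * B)"
      by (simp add: distrib_left sum.distrib sum_divide_distrib)
    also have "\<dots> = real (card X) * (real (card \<S>) * pair_avg \<Omega> W t +
        (\<Sum>f\<in>\<F>. pair_avg \<Omega> (\<lambda>x y. 1 - W x y) (card (f ` {..<s}))) / (2 * B))"
      unfolding ECl EIn by (simp add: distrib_left)
    also have "\<dots> < real (card X) * 1"
    proof (rule mult_strict_left_mono[OF _ cXpos])
      have "(\<Sum>f\<in>\<F>. pair_avg \<Omega> (\<lambda>x y. 1 - W x y) (card (f ` {..<s}))) / (2 * B) \<le> 1 / 2"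
        using inB Bpos by (simp add: field_simps)
      then show "real (card \<S>) * pair_avg \<Omega> W t +
        (\<Sum>f\<in>\<F>. pair_avg \<Omega> (\<lambda>x y. 1 - W x y) (card (f ` {..<s}))) / (2 * B) < 1"
        using cl by linarith
    qed
    finally show False by simp
  qed
  then obtain G where G: "G \<subseteq> P" and lt: "Cl G + In G / (2 * B) < 1" by auto
  have In0: "In G \<ge> 0" unfolding In_def by (auto intro: sum_nonneg)
  have Cl0: "Cl G \<ge> 0" unfolding Cl_def by (auto intro: sum_nonneg)
  have irr: "u < v" "u < n" "v < n" if "(u, v) \<in> G" for u v
    using that G by (auto simp: P_def pairs_def)
  have simple: "simple_graph (edge_rel G)"
    using irr by (auto simp: simple_graph_def edge_rel_def)
  have noclique: "\<not> contains_clique n (edge_rel G) t"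
  proof
    assume "contains_clique n (edge_rel G) t"
    then obtain S where S: "S \<in> \<S>" "\<And>u v. u \<in> S \<Longrightarrow> v \<in> S \<Longrightarrow> u \<noteq> v \<Longrightarrow> edge_rel G u v"
      unfolding contains_clique_def \<S>_def by blast
    have "pairs S \<subseteq> G"
    proof
      fix e assume "e \<in> pairs S"
      then obtain i j where "e = (i, j)" "i \<in> S" "j \<in> S" "i < j" by (auto simp: pairs_def)
      then show "e \<in> G" using S(2)[of i j] irr(1)[of j i] by (auto simp: edge_rel_def)
    qed
    then have "1 \<le> Cl G"
      unfolding Cl_def using member_le_sum[of S \<S> "\<lambda>S. of_bool (pairs S \<subseteq> G) :: real"] S(1) fin\<S> by simp
    then show False using lt In0 Bpos by (smt (verit) divide_nonneg_pos)
  qed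
  have eq: "{f \<in> {..<s} \<rightarrow>\<^sub>E {..<n}. \<forall>i<s. \<forall>j<s. \<not> edge_rel G (f i) (f j)} =
      {f \<in> \<F>. pairs (f ` {..<s}) \<inter> G = {}}"
  proof -
    have "(\<forall>i<s. \<forall>j<s. \<not> edge_rel G (f i) (f j)) \<longleftrightarrow> pairs (f ` {..<s}) \<inter> G = {}" for f :: "nat \<Rightarrow> nat"
    proof (intro iffI equalityI subsetI)
      fix e assume "\<forall>i<s. \<forall>j<s. \<not> edge_rel G (f i) (f j)" and "e \<in> pairs (f ` {..<s}) \<inter> G"
      then show "e \<in> {}" by (auto simp: edge_rel_def pairs_def)
    next
      assume dis: "pairs (f ` {..<s}) \<inter> G = {}"
      have "(f i, f j) \<notin> G" if "i < s" "j < s" for i j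
      proof
        assume "(f i, f j) \<in> G"
        moreover have "(f i, f j) \<in> pairs (f ` {..<s})"
          using irr(1)[OF calculation] that by (auto simp: pairs_def)
        ultimately show False using dis by blast
      qed
      then show "\<forall>i<s. \<forall>j<s. \<not> edge_rel G (f i) (f j)" by (simp add: edge_rel_def)
    qed auto
    then show ?thesis by (simp add: \<F>_def)
  qed
  have "In G = real (card {f \<in> \<F>. pairs (f ` {..<s}) \<inter> G = {}})"
    unfolding In_def using fin\<F> by (simp add: of_bool_def sum.If_cases Int_def)
  moreover have "In G \<le> 2 * B"
    using lt Cl0 Bpos by (smt (verit) divide_less_eq_1_pos)
  ultimately have "indep_prob n (edge_rel G) s \<le> 2 * B / real n ^ s"
    unfolding indep_prob_def eq by (simp add: divide_right_mono)
  then show ?thesis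
    using that[OF simple noclique] by (simp only: B_def mult.assoc)
qed

subsection \<open>Rademacher sums\<close>

definition rad_avg :: "nat \<Rightarrow> (real \<Rightarrow> real) \<Rightarrow> real" where
  "rad_avg k G = (\<Sum>x\<in>PiE {..<k} (\<lambda>_. {-1, 1}). G (\<Sum>i<k. x i)) / 2 ^ k"

lemma rad_avg_0 [simp]: "rad_avg 0 G = G 0"
  by (simp add: rad_avg_def)

lemma rad_avg_Suc: "rad_avg (Suc k) G = rad_avg k (\<lambda>y. (G (y + 1) + G (y - 1)) / 2)"
proof -
  have "(\<Sum>x\<in>PiE {..<Suc k} (\<lambda>_. {-1, 1}). G (\<Sum>i<Suc k. x i)) =
      (\<Sum>b\<in>{-1, 1}. \<Sum>x\<in>PiE {..<k} (\<lambda>_. {-1, 1::real}). G (\<Sum>i<Suc k. (x(k := b)) i))"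
    unfolding lessThan_Suc by (rule sum_PiE_insert) simp
  also have "\<dots> = (\<Sum>b\<in>{-1, 1}. \<Sum>x\<in>PiE {..<k} (\<lambda>_. {-1, 1::real}). G ((\<Sum>i<k. x i) + b))"
    by (intro sum.cong refl arg_cong[where f = G]) (auto intro!: sum.cong)
  also have "\<dots> = (\<Sum>x\<in>PiE {..<k} (\<lambda>_. {-1, 1::real}). G ((\<Sum>i<k. x i) + 1) + G ((\<Sum>i<k. x i) - 1))"
    by (simp add: sum.distrib)
  finally show ?thesis
    by (simp add: rad_avg_def sum_divide_distrib)
qed

lemma rad_avg_add: "rad_avg k (\<lambda>y. F y + G y) = rad_avg k F + rad_avg k G"
  by (simp add: rad_avg_def sum.distrib add_divide_distrib)

lemma rad_avg_cmult: "rad_avg k (\<lambda>y. c * F y) = c * rad_avg k F"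
  by (simp add: rad_avg_def sum_distrib_left[symmetric])

lemma rad_avg_const [simp]: "rad_avg k (\<lambda>y. c) = c"
  by (simp add: rad_avg_def card_PiE numeral_2_eq_2)

lemma rad_avg_mono: "(\<And>y. F y \<le> G y) \<Longrightarrow> rad_avg k F \<le> rad_avg k G"
  unfolding rad_avg_def by (intro divide_right_mono sum_mono) auto

lemma rad_avg_nonneg: "(\<And>y. 0 \<le> G y) \<Longrightarrow> 0 \<le> rad_avg k G"
  using rad_avg_mono[of "\<lambda>_. 0" G k] by simp

lemma rad_avg_square: "rad_avg k (\<lambda>y. y ^ 2) = real k"
proof (induction k)
  case (Suc k)
  have "(\<lambda>y::real. ((y + 1) ^ 2 + (y - 1) ^ 2) / 2) = (\<lambda>y. y ^ 2 + 1)"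
    by (intro ext) (simp add: power2_eq_square algebra_simps)
  with Suc show ?case by (simp add: rad_avg_Suc rad_avg_add)
qed simp

lemma rad_avg_power4: "rad_avg k (\<lambda>y. y ^ 4) = 3 * real k ^ 2 - 2 * real k"
proof (induction k)
  case (Suc k)
  have "(\<lambda>y::real. ((y + 1) ^ 4 + (y - 1) ^ 4) / 2) = (\<lambda>y. y ^ 4 + 6 * y ^ 2 + 1)"
    by (intro ext) (simp add: power4_eq_xxxx power2_eq_square algebra_simps)
  with Suc show ?case
    by (simp only: rad_avg_Suc rad_avg_add rad_avg_const rad_avg_cmult rad_avg_square)
      (simp add: power2_eq_square algebra_simps)
qed simp

lemma rad_avg_power6: "rad_avg k (\<lambda>y. y ^ 6) = 15 * real k ^ 3 - 30 * real k ^ 2 + 16 * real k"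
proof (induction k)
  case (Suc k)
  have "(\<lambda>y::real. ((y + 1) ^ 6 + (y - 1) ^ 6) / 2) = (\<lambda>y. y ^ 6 + 15 * y ^ 4 + 15 * y ^ 2 + 1)"
    by (intro ext) (simp add: eval_nat_numeral algebra_simps)
  with Suc show ?case
    by (simp only: rad_avg_Suc rad_avg_add rad_avg_const rad_avg_cmult rad_avg_square rad_avg_power4)
      (simp add: eval_nat_numeral algebra_simps)
qed simp

section \<open>Bounds for cosh and exponential moments of sign sums\<close>

text \<open>Termwise comparison of the two power series, using
  \<open>2 ^ n * fact n \<le> fact (2 * n)\<close>.\<close>

lemma cosh_le_exp_half_square: "cosh (x::real) \<le> exp (x ^ 2 / 2)"
proof -
  have scale: "y ^ n /\<^sub>R fact n = y ^ n / fact n" for y :: real and n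
    by (simp add: divide_inverse_commute)
  have s1: "(\<lambda>n. if even n then x ^ n /\<^sub>R fact n else 0) sums cosh x"
    by (rule cosh_converges)
  have s1': "(\<lambda>n. x ^ (2 * n) / fact (2 * n)) sums cosh x"
  proof -
    have "(\<lambda>n. (if even (2 * n) then x ^ (2 * n) /\<^sub>R fact (2 * n) else 0)) sums cosh x"
      by (subst sums_mono_reindex[of "\<lambda>n. 2 * n"])
        (use s1 in \<open>auto simp: strict_mono_def elim!: evenE\<close>)
    then show ?thesis by (simp only: scale) simp
  qed
  have s2: "(\<lambda>n. (x ^ 2 / 2) ^ n / fact n) sums exp (x ^ 2 / 2)"
    using exp_converges[of "x ^ 2 / 2"] by (simp only: scale)
  have fact: "2 ^ n * fact n \<le> (fact (2 * n) :: real)" for n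
  proof (induction n)
    case (Suc n)
    have "2 ^ Suc n * fact (Suc n) = (2 * (real n + 1)) * (2 ^ n * fact n :: real)"
      by (simp add: algebra_simps)
    also have "\<dots> \<le> (2 * (real n + 1)) * ((2 * real n + 1) * fact (2 * n))"
    proof (intro mult_left_mono)
      have "1 * fact (2 * n) \<le> (2 * real n + 1) * fact (2 * n)"
        by (intro mult_right_mono) auto
      then show "2 ^ n * fact n \<le> (2 * real n + 1) * fact (2 * n)" using Suc by linarith
    qed simp
    also have "\<dots> = fact (2 * Suc n)"
      by (simp add: algebra_simps)
    finally show ?case .
  qed simp
  show ?thesis
  proof (rule sums_le[OF _ s1' s2])
    fix n
    have "x ^ (2 * n) / fact (2 * n) \<le> x ^ (2 * n) / (2 ^ n * fact n)"
      by (intro divide_left_mono fact) (auto simp: power_mult)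
    then show "x ^ (2 * n) / fact (2 * n) \<le> (x ^ 2 / 2) ^ n / fact n"
      by (simp add: power_mult power_divide)
  qed
qed

text \<open>Combines \<open>1 + u ^ 2 / 2 \<le> cosh u\<close>, where the odd Taylor terms of
  \<open>exp u\<close> and \<open>exp (- u)\<close> cancel, with
  \<open>x - x ^ 2 \<le> ln (1 + x)\<close> at \<open>x = u ^ 2 / 2\<close>.\<close>

lemma cosh_ge_exp:
  fixes u :: real
  assumes "\<bar>u\<bar> \<le> 1"
  shows "exp (u ^ 2 / 2 - u ^ 4 / 4) \<le> cosh u"
proof -
  have taylor: "1 + z + z ^ 2 / 2 + z ^ 3 / 6 \<le> exp z" for z :: real
  proof -
    obtain t where "exp z = (\<Sum>m<4. z ^ m / fact m) + exp t / fact 4 * z ^ 4"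
      using Maclaurin_exp_le[of z 4] by blast
    moreover have "exp t / fact 4 * z ^ 4 \<ge> 0" by simp
    ultimately show ?thesis by (simp add: eval_nat_numeral lessThan_Suc)
  qed
  have c: "1 + u ^ 2 / 2 \<le> cosh u"
    using taylor[of u] taylor[of "- u"] by (simp add: cosh_field_def)
  have u1: "u ^ 2 \<le> 1" using assms by (simp add: abs_square_le_1)
  have "u ^ 2 / 2 - (u ^ 2 / 2) ^ 2 \<le> ln (1 + u ^ 2 / 2)"
    using u1 by (intro ln_one_plus_pos_lower_bound) auto
  then have "u ^ 2 / 2 - u ^ 4 / 4 \<le> ln (1 + u ^ 2 / 2)"
    by (simp add: power_divide flip: power_mult)
  moreover have "1 + u ^ 2 / 2 > 0" using zero_le_power2[of u] by linarith
  ultimately have "exp (u ^ 2 / 2 - u ^ 4 / 4) \<le> 1 + u ^ 2 / 2"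
    by (simp add: ln_ge_iff)
  with c show ?thesis by simp
qed

text \<open>Averaging out the last sign produces \<open>cosh (2 * y / x)\<close>; its Gaussian bound
  raises the coefficient \<open>1 / x\<close> to \<open>1 / x + 2 / x ^ 2 \<le> 1 / (x - 2)\<close>.
  Each sign thus lowers \<open>x\<close> by 2 at the cost of a factor
  \<open>exp (1 / x)\<close>.\<close>

lemma rad_avg_exp_square:
  assumes "real (2 * k) < x"
  shows "rad_avg k (\<lambda>y. exp (y ^ 2 / x)) \<le> exp (real k / (x - 2 * real k))"
  using assms
proof (induction k arbitrary: x)
  case (Suc k)
  have x: "x > 2" "x - 2 > 2 * real k" using Suc.prems by auto
  have "rad_avg (Suc k) (\<lambda>y. exp (y ^ 2 / x)) = rad_avg k (\<lambda>y. exp (1 / x) * (exp (y ^ 2 / x) * cosh (2 * y / x)))"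
    unfolding rad_avg_Suc
  proof (intro arg_cong[where f = "rad_avg k"] ext)
    fix y :: real
    have "(y + 1) ^ 2 / x = 1 / x + y ^ 2 / x + 2 * y / x" "(y - 1) ^ 2 / x = 1 / x + y ^ 2 / x + - (2 * y / x)"
      using x by (auto simp: power2_eq_square field_simps)
    then show "(exp ((y + 1) ^ 2 / x) + exp ((y - 1) ^ 2 / x)) / 2 = exp (1 / x) * (exp (y ^ 2 / x) * cosh (2 * y / x))"
      by (simp only: exp_add) (simp add: cosh_field_def field_simps)
  qed
  also have "\<dots> \<le> rad_avg k (\<lambda>y. exp (1 / x) * exp (y ^ 2 / (x - 2)))"
  proof (intro rad_avg_mono mult_left_mono)
    fix y :: real
    have "exp (y ^ 2 / x) * cosh (2 * y / x) \<le> exp (y ^ 2 / x) * exp ((2 * y / x) ^ 2 / 2)"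
      by (intro mult_left_mono cosh_le_exp_half_square) auto
    also have "\<dots> = exp (y ^ 2 * (1 / x + 2 / x ^ 2))"
      by (simp add: exp_add[symmetric] power2_eq_square field_simps)
    also have "1 / x + 2 / x ^ 2 \<le> 1 / (x - 2)"
      using x by (simp add: field_simps power2_eq_square)
    then have "exp (y ^ 2 * (1 / x + 2 / x ^ 2)) \<le> exp (y ^ 2 * (1 / (x - 2)))"
      by (simp add: mult_left_mono del: times_divide_eq_right)
    finally show "exp (y ^ 2 / x) * cosh (2 * y / x) \<le> exp (y ^ 2 / (x - 2))" by simp
  qed auto
  also have "\<dots> \<le> exp (1 / x) * exp (real k / (x - 2 - 2 * real k))"
    unfolding rad_avg_cmult by (intro mult_left_mono Suc.IH) (use x in auto)
  also have "\<dots> = exp (1 / x + real k / (x - 2 - 2 * real k))"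
    by (simp add: exp_add)
  also have "\<dots> \<le> exp (real (Suc k) / (x - 2 * real (Suc k)))"
  proof -
    have "1 / x \<le> 1 / (x - 2 - 2 * real k)"
      using x by (intro divide_left_mono) auto
    then show ?thesis by (simp add: add_divide_distrib algebra_simps)
  qed
  finally show ?case .
qed simp

lemma exp_le_Taylor4:
  fixes z :: real
  shows "exp z \<le> 1 + z + z ^ 2 / 2 + z ^ 3 / 6 + z ^ 4 / 24 * exp \<bar>z\<bar>"
proof -
  obtain t where t: "\<bar>t\<bar> \<le> \<bar>z\<bar>" "exp z = (\<Sum>m<4. z ^ m / fact m) + exp t / fact 4 * z ^ 4"
    using Maclaurin_exp_le[of z 4] by blast
  have "exp t * z ^ 4 \<le> exp \<bar>z\<bar> * z ^ 4"
    using t(1) by (intro mult_right_mono) auto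
  then show ?thesis
    unfolding t(2) by (simp add: eval_nat_numeral lessThan_Suc field_simps)
qed

text \<open>The degree-4 term of the exponential series suffices; 98304 is
  \<open>fact 4 * 8 ^ 4\<close>.\<close>

lemma power4_le_exp:
  assumes "q \<ge> (0::real)"
  shows "q ^ 4 \<le> 98304 * exp (q / 8)"
proof -
  have "(q / 8) ^ 4 / fact 4 \<le> exp (q / 8)"
  proof -
    obtain t where "exp (q / 8) = (\<Sum>m<5. (q / 8) ^ m / fact m) + exp t / fact 5 * (q / 8) ^ 5"
      using Maclaurin_exp_le[of "q / 8" 5] by blast
    moreover have "(q / 8) ^ 4 / fact 4 \<le> (\<Sum>m<5. (q / 8) ^ m / fact m)"
      by (rule member_le_sum[of 4 "{..<5}" "\<lambda>m. (q / 8) ^ m / fact m"]) (use assms in auto)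
    moreover have "exp t / fact 5 * (q / 8) ^ 5 \<ge> 0"
      using assms by simp
    ultimately show ?thesis by linarith
  qed
  then show ?thesis by (simp add: fact_numeral power_divide)
qed

text \<open>With \<open>Z = (S\<^sup>2 - k) / 2\<close> the sum of \<open>x\<^sub>i x\<^sub>j\<close> over pairs, the cubic coefficient counts triangles.\<close>

lemma rad_avg_exp_chaos:
  fixes u :: real
  assumes "\<bar>u\<bar> * real k \<le> 1 / 4"
  shows "rad_avg k (\<lambda>S. exp (u * ((S ^ 2 - real k) / 2)))
    \<le> exp (u ^ 2 * (real k * (real k - 1) / 4) + u ^ 3 * (real k * (real k - 1) * (real k - 2) / 6)
         + 12288 * (u * real k) ^ 4)"
proof (cases "k = 0")
  case False
  define Z where "Z S = (S ^ 2 - real k) / 2" for S :: real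
  have kpos: "real k > 0" using False by simp
  have Z2: "rad_avg k (\<lambda>S. Z S ^ 2) = real k * (real k - 1) / 2"
  proof -
    have "(\<lambda>S. Z S ^ 2) = (\<lambda>S. (1 / 4) * S ^ 4 + (- real k / 2) * S ^ 2 + real k ^ 2 / 4)"
      by (intro ext) (simp add: Z_def eval_nat_numeral field_simps)
    then show ?thesis
      by (simp only: rad_avg_add rad_avg_cmult rad_avg_const rad_avg_square rad_avg_power4)
        (simp add: power2_eq_square field_simps)
  qed
  have Z3: "rad_avg k (\<lambda>S. Z S ^ 3) = real k * (real k - 1) * (real k - 2)"
  proof -
    have "(\<lambda>S. Z S ^ 3) = (\<lambda>S. (1 / 8) * S ^ 6 + (- 3 * real k / 8) * S ^ 4 + (3 * real k ^ 2 / 8) * S ^ 2 + - (real k ^ 3 / 8))"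
      by (intro ext) (simp add: Z_def eval_nat_numeral field_simps)
    then show ?thesis
      by (simp only: rad_avg_add rad_avg_cmult rad_avg_const rad_avg_square rad_avg_power4 rad_avg_power6)
        (simp add: eval_nat_numeral field_simps)
  qed
  have Z1: "rad_avg k Z = 0"
  proof -
    have "Z = (\<lambda>S. (1 / 2) * S ^ 2 + - real k / 2)"
      by (intro ext) (simp add: Z_def field_simps)
    then show ?thesis
      by (simp only: rad_avg_add rad_avg_cmult rad_avg_const rad_avg_square)
  qed
  \<comment> \<open>Fourth-order remainder. With \<open>q = (S ^ 2 / k + 1) / 2\<close>,
    \<open>\<bar>Z S\<bar>\<close> is at most \<open>k * q\<close> and
    \<open>\<bar>u * Z S\<bar>\<close> at most \<open>q / 4\<close>. Absorbing \<open>q ^ 4\<close>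
    into \<open>exp (q / 8)\<close> leaves \<open>exp (3 * q / 8)\<close>, where
    \<open>S ^ 2 / k\<close> has coefficient 3/16; this is rounded up to 1/4 so that
    \<open>rad_avg_exp_square\<close> applies with \<open>x = 4 * k\<close>. The constant is
    \<open>294912 = 3 * 98304 = 24 * 12288\<close>.\<close>
  have tail: "rad_avg k (\<lambda>S. Z S ^ 4 * exp \<bar>u * Z S\<bar>) \<le> 294912 * real k ^ 4"
  proof -
    have pt: "Z S ^ 4 * exp \<bar>u * Z S\<bar> \<le> (98304 * real k ^ 4 * exp (3 / 16)) * exp (S ^ 2 / (4 * real k))" for S
    proof -
      define q where "q = (S ^ 2 / real k + 1) / 2"
      have q0: "q \<ge> 0" by (simp add: q_def)
      have Zq: "\<bar>Z S\<bar> \<le> real k * q"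
        using kpos zero_le_power2[of S] unfolding Z_def q_def by (simp add: field_simps abs_if)
      have "Z S ^ 4 = \<bar>Z S\<bar> ^ 4" by simp
      also have "\<dots> \<le> (real k * q) ^ 4" using Zq by (intro power_mono) auto
      also have "\<dots> \<le> real k ^ 4 * (98304 * exp (q / 8))"
        unfolding power_mult_distrib by (intro mult_left_mono power4_le_exp q0) auto
      finally have a: "Z S ^ 4 \<le> 98304 * real k ^ 4 * exp (q / 8)" by simp
      have "\<bar>u * Z S\<bar> \<le> \<bar>u\<bar> * (real k * q)"
        using Zq by (simp add: abs_mult mult_left_mono)
      also have "\<dots> \<le> q / 4"
        using mult_right_mono[OF assms q0] by simp
      finally have b: "exp \<bar>u * Z S\<bar> \<le> exp (q / 4)" by simp
      have "Z S ^ 4 * exp \<bar>u * Z S\<bar> \<le> 98304 * real k ^ 4 * exp (q / 8) * exp (q / 4)"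
        by (intro mult_mono a b) auto
      also have "\<dots> = 98304 * real k ^ 4 * exp (3 / 16 + 3 / 16 * (S ^ 2 / real k))"
        by (simp add: mult.assoc exp_add[symmetric] q_def field_simps)
      also have "\<dots> \<le> 98304 * real k ^ 4 * exp (3 / 16 + 1 / 4 * (S ^ 2 / real k))"
        using kpos by (intro mult_left_mono) (auto simp: field_simps)
      finally show ?thesis by (simp add: exp_add mult.assoc)
    qed
    have "rad_avg k (\<lambda>S. Z S ^ 4 * exp \<bar>u * Z S\<bar>) \<le>
        (98304 * real k ^ 4 * exp (3 / 16)) * rad_avg k (\<lambda>S. exp (S ^ 2 / (4 * real k)))"
      unfolding rad_avg_cmult[symmetric] by (rule rad_avg_mono) (rule pt)
    also have "\<dots> \<le> (98304 * real k ^ 4 * exp (3 / 16)) * exp (1 / 2)"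
    proof (intro mult_left_mono)
      have "rad_avg k (\<lambda>S. exp (S ^ 2 / (4 * real k))) \<le> exp (real k / (4 * real k - 2 * real k))"
        using rad_avg_exp_square[of k "4 * real k"] kpos by simp
      also have "real k / (4 * real k - 2 * real k) = 1 / 2" using kpos by simp
      finally show "rad_avg k (\<lambda>S. exp (S ^ 2 / (4 * real k))) \<le> exp (1 / 2)" .
    qed auto
    also have "\<dots> = 98304 * real k ^ 4 * exp (11 / 16)"
      by (simp add: mult.assoc exp_add[symmetric])
    also have "\<dots> \<le> 98304 * real k ^ 4 * 3"
    proof (intro mult_left_mono)
      have "exp (11 / 16 :: real) \<le> exp 1" by simp
      then show "exp (11 / 16 :: real) \<le> 3" using exp_le by linarith
    qed auto
    finally show ?thesis by simp
  qed
  have "rad_avg k (\<lambda>S. exp (u * Z S)) \<le>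
      rad_avg k (\<lambda>S. 1 + u * Z S + (u ^ 2 / 2) * Z S ^ 2 + (u ^ 3 / 6) * Z S ^ 3 + (u ^ 4 / 24) * (Z S ^ 4 * exp \<bar>u * Z S\<bar>))"
  proof (rule rad_avg_mono)
    fix S
    show "exp (u * Z S) \<le> 1 + u * Z S + (u ^ 2 / 2) * Z S ^ 2 + (u ^ 3 / 6) * Z S ^ 3 + (u ^ 4 / 24) * (Z S ^ 4 * exp \<bar>u * Z S\<bar>)"
      using exp_le_Taylor4[of "u * Z S"] by (simp add: power_mult_distrib mult.assoc)
  qed
  also have "\<dots> = 1 + (u ^ 2 / 2) * (real k * (real k - 1) / 2) + (u ^ 3 / 6) * (real k * (real k - 1) * (real k - 2))
       + (u ^ 4 / 24) * rad_avg k (\<lambda>S. Z S ^ 4 * exp \<bar>u * Z S\<bar>)"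
    by (simp only: rad_avg_add rad_avg_cmult rad_avg_const Z1 Z2 Z3 mult_zero_right add_0_right)
  also have "\<dots> \<le> 1 + (u ^ 2 / 2) * (real k * (real k - 1) / 2) + (u ^ 3 / 6) * (real k * (real k - 1) * (real k - 2))
       + (u ^ 4 / 24) * (294912 * real k ^ 4)"
    by (intro add_left_mono mult_left_mono tail) auto
  also have "\<dots> = 1 + (u ^ 2 * (real k * (real k - 1) / 4) + u ^ 3 * (real k * (real k - 1) * (real k - 2) / 6)
         + 12288 * (u * real k) ^ 4)"
    by (simp add: power_mult_distrib)
  also have "\<dots> \<le> exp (u ^ 2 * (real k * (real k - 1) / 4) + u ^ 3 * (real k * (real k - 1) * (real k - 2) / 6)
         + 12288 * (u * real k) ^ 4)"
    by (rule exp_ge_add_one_self)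
  finally show ?thesis by (simp only: Z_def)
qed simp

section \<open>Sums of pair products over sign vectors\<close>

lemma sum_pairs_products:
  assumes "\<And>i. i < k \<Longrightarrow> x i ^ 2 = (1::real)"
  shows "(\<Sum>(i, j)\<in>pairs {..<k}. x i * x j) = ((\<Sum>i<k. x i) ^ 2 - real k) / 2"
  using assms
proof (induction k)
  case 0
  then show ?case by (simp add: pairs_def)
next
  case (Suc k)
  then have "(\<Sum>(i, j)\<in>pairs {..<k}. x i * x j) = ((\<Sum>i<k. x i) ^ 2 - real k) / 2" and "x k ^ 2 = 1"
    by auto
  then show ?case
    unfolding sum_pairs_lessThan_Suc
    by (simp add: sum_distrib_right[symmetric] power2_eq_square algebra_simps)
qed

lemma sum_exp_pairs_eq_rad_avg:
  "(\<Sum>x\<in>PiE {..<k} (\<lambda>_. {-1, 1::real}). exp (u * (\<Sum>(i, j)\<in>pairs {..<k}. x i * x j))) =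
   2 ^ k * rad_avg k (\<lambda>S. exp (u * ((S ^ 2 - real k) / 2)))"
proof -
  have "(\<Sum>x\<in>PiE {..<k} (\<lambda>_. {-1, 1::real}). exp (u * (\<Sum>(i, j)\<in>pairs {..<k}. x i * x j))) =
    (\<Sum>x\<in>PiE {..<k} (\<lambda>_. {-1, 1::real}). exp (u * (((\<Sum>i<k. x i) ^ 2 - real k) / 2)))"
  proof (intro sum.cong refl)
    fix x :: "nat \<Rightarrow> real" assume x: "x \<in> PiE {..<k} (\<lambda>_. {-1, 1})"
    have "x i ^ 2 = 1" if "i < k" for i
      using PiE_mem[OF x, of i] that by auto
    then show "exp (u * (\<Sum>(i, j)\<in>pairs {..<k}. x i * x j)) = exp (u * (((\<Sum>i<k. x i) ^ 2 - real k) / 2))"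
      by (simp add: sum_pairs_products)
  qed
  then show ?thesis by (simp add: rad_avg_def)
qed

text \<open>The product is a monomial in the \<open>x i\<close>, so its sum over sign vectors
  factors over the coordinates; a factor is 2 for an even exponent and 0 for an odd one.\<close>

lemma sum_signs_pair_products_nonneg:
  fixes H :: "(nat \<times> nat) set"
  assumes "finite H" and "H \<subseteq> {..<k} \<times> {..<k}"
  shows "0 \<le> (\<Sum>x\<in>PiE {..<k} (\<lambda>_. {-1, 1::real}). \<Prod>(i, j)\<in>H. x i * x j)"
proof -
  have "\<exists>n. \<forall>x :: nat \<Rightarrow> real. (\<Prod>(i, j)\<in>H. x i * x j) = (\<Prod>i<k. x i ^ n i)"
    using assms
  proof (induction H rule: finite_induct)
    case empty
    show ?case by (rule exI[of _ "\<lambda>_. 0"]) simp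
  next
    case (insert e H)
    then obtain n where n: "\<And>x :: nat \<Rightarrow> real. (\<Prod>(i, j)\<in>H. x i * x j) = (\<Prod>i<k. x i ^ n i)" by auto
    obtain a b where e: "e = (a, b)" "a < k" "b < k" using insert.prems by auto
    have one: "y = (\<Prod>i<k. x i ^ of_bool (i = a))" if "a < k" "y = x a" for a y and x :: "nat \<Rightarrow> real"
    proof -
      have "(\<Prod>i<k. x i ^ of_bool (i = a)) = (\<Prod>i<k. if i = a then x i else 1)"
        by (intro prod.cong) auto
      then show ?thesis using that by (simp add: prod.delta)
    qed
    have "(\<Prod>(i, j)\<in>insert e H. x i * x j) = (\<Prod>i<k. x i ^ (of_bool (i = a) + of_bool (i = b) + n i))"
      for x :: "nat \<Rightarrow> real"
    proof -
      have "(\<Prod>(i, j)\<in>insert e H. x i * x j) = (x a * x b) * (\<Prod>i<k. x i ^ n i)"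
        using insert.hyps by (simp add: e n)
      also have "\<dots> = ((\<Prod>i<k. x i ^ of_bool (i = a)) * (\<Prod>i<k. x i ^ of_bool (i = b))) * (\<Prod>i<k. x i ^ n i)"
        using one[OF e(2) refl, of x] one[OF e(3) refl, of x] by simp
      also have "\<dots> = (\<Prod>i<k. x i ^ (of_bool (i = a) + of_bool (i = b) + n i))"
        by (simp only: prod.distrib[symmetric] power_add)
      finally show ?thesis .
    qed
    then show ?case by (intro exI[of _ "\<lambda>i. of_bool (i = a) + of_bool (i = b) + n i"]) blast
  qed
  then obtain n where n: "\<And>x :: nat \<Rightarrow> real. (\<Prod>(i, j)\<in>H. x i * x j) = (\<Prod>i<k. x i ^ n i)" by blast
  have "(\<Sum>x\<in>PiE {..<k} (\<lambda>_. {-1, 1::real}). \<Prod>(i, j)\<in>H. x i * x j) =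
      (\<Prod>i<k. \<Sum>y\<in>{-1, 1::real}. y ^ n i)"
    unfolding n by (rule prod_sum_PiE[symmetric]) auto
  also have "\<dots> \<ge> 0"
    by (intro prod_nonneg) (auto simp: minus_one_power_iff)
  finally show ?thesis .
qed

text \<open>Expanding over sets \<open>H\<close> of pairs gives the coefficients
  \<open>\<Prod>e\<in>H. \<alpha> e\<close> times sign sums that are nonnegative by
  \<open>sum_signs_pair_products_nonneg\<close>. Hence the comparison holds coefficient by
  coefficient.\<close>

lemma sum_signs_prod_mono:
  fixes \<alpha> :: "nat \<times> nat \<Rightarrow> real"
  assumes "\<And>e. e \<in> pairs {..<k} \<Longrightarrow> \<bar>\<alpha> e\<bar> \<le> \<beta>"
  shows "(\<Sum>x\<in>PiE {..<k} (\<lambda>_. {-1, 1}). \<Prod>(i, j)\<in>pairs {..<k}. 1 + \<alpha> (i, j) * (x i * x j))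
    \<le> (\<Sum>x\<in>PiE {..<k} (\<lambda>_. {-1, 1}). \<Prod>(i, j)\<in>pairs {..<k}. 1 + \<beta> * (x i * x j))"
proof -
  let ?X = "PiE {..<k} (\<lambda>_. {-1, 1::real})" and ?P = "pairs {..<k}"
  have expand: "(\<Sum>x\<in>?X. \<Prod>(i, j)\<in>?P. 1 + a (i, j) * (x i * x j)) =
      (\<Sum>H\<in>Pow ?P. (\<Prod>e\<in>H. a e) * (\<Sum>x\<in>?X. \<Prod>(i, j)\<in>H. x i * x j))" for a
  proof -
    have "(\<Sum>x\<in>?X. \<Prod>(i, j)\<in>?P. 1 + a (i, j) * (x i * x j)) =
        (\<Sum>x\<in>?X. \<Sum>H\<in>Pow ?P. (\<Prod>e\<in>H. a e) * (\<Prod>(i, j)\<in>H. x i * x j))"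
    proof (intro sum.cong refl)
      fix x
      have "(\<Prod>(i, j)\<in>?P. 1 + a (i, j) * (x i * x j)) = (\<Prod>e\<in>?P. a e * (x (fst e) * x (snd e)) + 1)"
        by (intro prod.cong) auto
      also have "\<dots> = (\<Sum>H\<in>Pow ?P. (\<Prod>e\<in>H. a e * (x (fst e) * x (snd e))) * (\<Prod>e\<in>?P - H. 1))"
        by (rule prod_add) simp
      also have "\<dots> = (\<Sum>H\<in>Pow ?P. (\<Prod>e\<in>H. a e) * (\<Prod>(i, j)\<in>H. x i * x j))"
        by (simp add: prod.distrib case_prod_unfold)
      finally show "(\<Prod>(i, j)\<in>?P. 1 + a (i, j) * (x i * x j)) = (\<Sum>H\<in>Pow ?P. (\<Prod>e\<in>H. a e) * (\<Prod>(i, j)\<in>H. x i * x j))" .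
    qed
    also have "\<dots> = (\<Sum>H\<in>Pow ?P. \<Sum>x\<in>?X. (\<Prod>e\<in>H. a e) * (\<Prod>(i, j)\<in>H. x i * x j))"
      by (rule sum.swap)
    finally show ?thesis by (simp add: sum_distrib_left)
  qed
  show ?thesis
    unfolding expand[of \<alpha>] expand[of "\<lambda>_. \<beta>"]
  proof (intro sum_mono mult_right_mono)
    fix H assume H: "H \<in> Pow ?P"
    have "(\<Prod>e\<in>H. \<alpha> e) \<le> \<bar>\<Prod>e\<in>H. \<alpha> e\<bar>" by simp
    also have "\<dots> = (\<Prod>e\<in>H. \<bar>\<alpha> e\<bar>)" by (rule abs_prod)
    also have "\<dots> \<le> (\<Prod>e\<in>H. \<beta>)"
      using H assms by (intro prod_mono) auto
    finally show "(\<Prod>e\<in>H. \<alpha> e) \<le> (\<Prod>e\<in>H. \<beta>)" .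
    show "0 \<le> (\<Sum>x\<in>?X. \<Prod>(i, j)\<in>H. x i * x j)"
    proof (rule sum_signs_pair_products_nonneg)
      show "finite H" using H finite_subset[of H ?P] by simp
      show "H \<subseteq> {..<k} \<times> {..<k}" using H by (auto simp: pairs_def)
    qed
  qed
qed

subsection \<open>Features in the discrete cube\<close>

text \<open>Lists make revealing the first coordinate of a feature a structural step.\<close>

definition cube :: "nat \<Rightarrow> real list set" where
  "cube d = {xs. set xs \<subseteq> {-1, 1} \<and> length xs = d}"

definition dot :: "real list \<Rightarrow> real list \<Rightarrow> real" where
  "dot xs ys = (\<Sum>(x, y)\<leftarrow>zip xs ys. x * y)"

lemma finite_cube [simp]: "finite (cube d)"
  unfolding cube_def by (rule finite_lists_length_eq) simp

lemma card_cube [simp]: "card (cube d) = 2 ^ d"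
  unfolding cube_def by (subst card_lists_length_eq) (auto simp: numeral_2_eq_2)

lemma cube_nonempty [simp]: "cube d \<noteq> {}"
  by (metis card.empty card_cube power_eq_0_iff zero_neq_numeral)

lemma cube_0 [simp]: "cube 0 = {[]}"
  by (auto simp: cube_def)

lemma dot_Cons [simp]: "dot (a # x) (b # y) = a * b + dot x y"
  by (simp add: dot_def)

lemma dot_Nil [simp]: "dot [] [] = 0"
  by (simp add: dot_def)

lemma sum_PiE_cube_Suc:
  fixes I :: "'a set"
  shows "(\<Sum>x\<in>PiE I (\<lambda>_. cube (Suc d)). F x) =
   (\<Sum>y\<in>PiE I (\<lambda>_. {-1, 1}). \<Sum>z\<in>PiE I (\<lambda>_. cube d). F (restrict (\<lambda>i. y i # z i) I))"
proof -
  have "(\<Sum>x\<in>PiE I (\<lambda>_. cube (Suc d)). F x) =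
      (\<Sum>(y, z)\<in>PiE I (\<lambda>_. {-1, 1}) \<times> PiE I (\<lambda>_. cube d). F (restrict (\<lambda>i. y i # z i) I))"
  proof (rule sum.reindex_bij_witness[where
        i = "\<lambda>p. restrict (\<lambda>i. fst p i # snd p i) I" and
        j = "\<lambda>x. (restrict (\<lambda>i. hd (x i)) I, restrict (\<lambda>i. tl (x i)) I)"])
    fix x :: "'a \<Rightarrow> real list" assume x: "x \<in> PiE I (\<lambda>_. cube (Suc d))"
    have c: "hd (x i) \<in> {-1, 1}" "tl (x i) \<in> cube d" "x i = hd (x i) # tl (x i)" if "i \<in> I" for i
      using PiE_mem[OF x that] by (cases "x i"; auto simp: cube_def)+
    show *: "restrict (\<lambda>i. fst (restrict (\<lambda>i. hd (x i)) I, restrict (\<lambda>i. tl (x i)) I) i #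
        snd (restrict (\<lambda>i. hd (x i)) I, restrict (\<lambda>i. tl (x i)) I) i) I = x"
    proof
      fix i
      show "restrict (\<lambda>i. fst (restrict (\<lambda>i. hd (x i)) I, restrict (\<lambda>i. tl (x i)) I) i #
        snd (restrict (\<lambda>i. hd (x i)) I, restrict (\<lambda>i. tl (x i)) I) i) I i = x i"
        using c(3)[of i, symmetric] PiE_arb[OF x, of i] by (cases "i \<in> I") simp_all
    qed
    show "(restrict (\<lambda>i. hd (x i)) I, restrict (\<lambda>i. tl (x i)) I)
        \<in> PiE I (\<lambda>_. {-1, 1}) \<times> PiE I (\<lambda>_. cube d)"
      using c by (simp add: PiE_iff)
    show "(case (restrict (\<lambda>i. hd (x i)) I, restrict (\<lambda>i. tl (x i)) I) of
        (y, z) \<Rightarrow> F (restrict (\<lambda>i. y i # z i) I)) = F x"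
      using * by simp
  next
    fix p :: "('a \<Rightarrow> real) \<times> ('a \<Rightarrow> real list)"
    assume p: "p \<in> PiE I (\<lambda>_. {-1, 1}) \<times> PiE I (\<lambda>_. cube d)"
    then have p1: "fst p \<in> PiE I (\<lambda>_. {-1, 1})" and p2: "snd p \<in> PiE I (\<lambda>_. cube d)" by auto
    have "restrict (\<lambda>i. hd (restrict (\<lambda>i. fst p i # snd p i) I i)) I = fst p"
    proof
      fix i show "restrict (\<lambda>i. hd (restrict (\<lambda>i. fst p i # snd p i) I i)) I i = fst p i"
        using PiE_arb[OF p1, of i] by (cases "i \<in> I") simp_all
    qed
    moreover have "restrict (\<lambda>i. tl (restrict (\<lambda>i. fst p i # snd p i) I i)) I = snd p"
    proof
      fix i show "restrict (\<lambda>i. tl (restrict (\<lambda>i. fst p i # snd p i) I i)) I i = snd p i"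
        using PiE_arb[OF p2, of i] by (cases "i \<in> I") simp_all
    qed
    ultimately show "(restrict (\<lambda>i. hd (restrict (\<lambda>i. fst p i # snd p i) I i)) I,
        restrict (\<lambda>i. tl (restrict (\<lambda>i. fst p i # snd p i) I i)) I) = p"
      by simp
    show "restrict (\<lambda>i. fst p i # snd p i) I \<in> PiE I (\<lambda>_. cube (Suc d))"
    proof -
      have "fst p i # snd p i \<in> cube (Suc d)" if "i \<in> I" for i
        using PiE_mem[OF p1 that] PiE_mem[OF p2 that] by (simp add: cube_def)
      then show ?thesis by (simp add: PiE_iff)
    qed
  qed
  then show ?thesis by (simp add: sum.cartesian_product)
qed

text \<open>The coordinates of the features are revealed one at a time; \<open>V m\<close> is the weight of a pair when
  \<open>m\<close> coordinates are still hidden.\<close>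

lemma sum_cube_le:
  fixes V :: "nat \<Rightarrow> real \<Rightarrow> real" and K :: "nat \<times> nat \<Rightarrow> real"
  assumes R: "0 \<le> R"
    and step: "\<And>m K. (\<Sum>y\<in>PiE {..<k} (\<lambda>_. {-1, 1}). \<Prod>(i, j)\<in>pairs {..<k}. V m (K (i, j) + h * (y i * y j)))
        \<le> R * (\<Prod>e\<in>pairs {..<k}. V (Suc m) (K e))"
  shows "(\<Sum>x\<in>PiE {..<k} (\<lambda>_. cube d). \<Prod>(i, j)\<in>pairs {..<k}. V 0 (K (i, j) + h * dot (x i) (x j)))
      \<le> R ^ d * (\<Prod>e\<in>pairs {..<k}. V d (K e))"
proof (induction d arbitrary: K)
  case 0
  have "(\<Sum>x\<in>PiE {..<k} (\<lambda>_. cube 0). \<Prod>(i, j)\<in>pairs {..<k}. V 0 (K (i, j) + h * dot (x i) (x j))) =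
      (\<Sum>x\<in>{restrict (\<lambda>_. []) {..<k}}. \<Prod>(i, j)\<in>pairs {..<k}. V 0 (K (i, j) + h * dot (x i) (x j)))"
    by (simp add: PiE_singleton restrict_def)
  also have "\<dots> = (\<Prod>e\<in>pairs {..<k}. V 0 (K e))"
    by (simp, rule prod.cong) (auto simp: pairs_def)
  finally show ?case by simp
next
  case (Suc d)
  let ?P = "pairs {..<k}"
  \<comment> \<open>The revealed heads only shift the offset of a pair by
    \<open>h * (y i * y j)\<close>. The induction hypothesis is used at the shifted offset, hence
    the generalisation over \<open>K\<close>.\<close>
  have "(\<Sum>x\<in>PiE {..<k} (\<lambda>_. cube (Suc d)). \<Prod>(i, j)\<in>?P. V 0 (K (i, j) + h * dot (x i) (x j))) =
      (\<Sum>y\<in>PiE {..<k} (\<lambda>_. {-1, 1}). \<Sum>z\<in>PiE {..<k} (\<lambda>_. cube d).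
        \<Prod>(i, j)\<in>?P. V 0 ((case (i, j) of (i, j) \<Rightarrow> K (i, j) + h * (y i * y j)) + h * dot (z i) (z j)))"
    unfolding sum_PiE_cube_Suc
  proof (intro sum.cong prod.cong refl)
    fix y z e assume "e \<in> ?P"
    then show "(case e of (i, j) \<Rightarrow> V 0 (K (i, j) +
          h * dot (restrict (\<lambda>i. y i # z i) {..<k} i) (restrict (\<lambda>i. y i # z i) {..<k} j))) =
        (case e of (i, j) \<Rightarrow> V 0 ((case (i, j) of (i, j) \<Rightarrow> K (i, j) + h * (y i * y j)) + h * dot (z i) (z j)))"
      by (cases e) (simp add: pairs_def distrib_left add.assoc)
  qed
  also have "\<dots> \<le> (\<Sum>y\<in>PiE {..<k} (\<lambda>_. {-1, 1}).
      R ^ d * (\<Prod>e\<in>?P. V d (case e of (i, j) \<Rightarrow> K (i, j) + h * (y i * y j))))"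
    by (intro sum_mono Suc.IH)
  also have "\<dots> = R ^ d * (\<Sum>y\<in>PiE {..<k} (\<lambda>_. {-1, 1}). \<Prod>(i, j)\<in>?P. V d (K (i, j) + h * (y i * y j)))"
    by (simp add: sum_distrib_left case_prod_unfold)
  also have "\<dots> \<le> R ^ d * (R * (\<Prod>e\<in>?P. V (Suc d) (K e)))"
    by (intro mult_left_mono step) (simp add: R)
  finally show ?case by (simp add: mult_ac)
qed

lemma pair_avg_mono:
  assumes "\<And>x y. 0 \<le> w x y" and "\<And>x y. w x y \<le> w' x y"
  shows "pair_avg \<Omega> w k \<le> pair_avg \<Omega> w' k"
  unfolding pair_avg_def
  by (intro divide_right_mono sum_mono prod_mono) (use assms in auto)

lemma pair_avg_cmult:
  "pair_avg \<Omega> (\<lambda>x y. c * w x y) k = c ^ card (pairs {..<k}) * pair_avg \<Omega> w k"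
  by (simp add: pair_avg_def case_prod_unfold prod.distrib sum_distrib_left)

text \<open>For an exponential weight the offset factors out, so \<open>V m K = exp (u * K)\<close>
  serves at every level \<open>m\<close> and all \<open>d\<close> coordinates contribute the same
  factor.\<close>

lemma pair_avg_cube_exp:
  "pair_avg (cube d) (\<lambda>x y. exp (u * dot x y)) k \<le> rad_avg k (\<lambda>S. exp (u * ((S ^ 2 - real k) / 2))) ^ d"
proof -
  define R where "R = 2 ^ k * rad_avg k (\<lambda>S. exp (u * ((S ^ 2 - real k) / 2)))"
  have R0: "R \<ge> 0"
    unfolding R_def sum_exp_pairs_eq_rad_avg[symmetric] by (intro sum_nonneg) auto
  have "(\<Sum>x\<in>PiE {..<k} (\<lambda>_. cube d). \<Prod>(i, j)\<in>pairs {..<k}. (\<lambda>m K. exp (u * K)) (0::nat) ((\<lambda>e. 0) (i, j) + 1 * dot (x i) (x j)))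
      \<le> R ^ d * (\<Prod>e\<in>pairs {..<k}. (\<lambda>m K. exp (u * K)) d ((\<lambda>e. 0) e))"
  proof (rule sum_cube_le[OF R0])
    fix m :: nat and K :: "nat \<times> nat \<Rightarrow> real"
    have "(\<Sum>y\<in>PiE {..<k} (\<lambda>_. {-1, 1}). \<Prod>(i, j)\<in>pairs {..<k}. exp (u * (K (i, j) + 1 * (y i * y j)))) =
        (\<Sum>y\<in>PiE {..<k} (\<lambda>_. {-1, 1}). exp (u * (\<Sum>(i, j)\<in>pairs {..<k}. y i * y j)) * (\<Prod>e\<in>pairs {..<k}. exp (u * K e)))"
      by (simp add: distrib_left exp_add case_prod_unfold prod.distrib exp_sum sum_distrib_left mult.commute)
    also have "\<dots> = R * (\<Prod>e\<in>pairs {..<k}. exp (u * K e))"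
      by (simp only: sum_distrib_right[symmetric] sum_exp_pairs_eq_rad_avg R_def)
    finally show "(\<Sum>y\<in>PiE {..<k} (\<lambda>_. {-1, 1}). \<Prod>(i, j)\<in>pairs {..<k}. exp (u * (K (i, j) + 1 * (y i * y j))))
      \<le> R * (\<Prod>e\<in>pairs {..<k}. exp (u * K e))" by simp
  qed
  then have "(\<Sum>x\<in>PiE {..<k} (\<lambda>_. cube d). \<Prod>(i, j)\<in>pairs {..<k}. exp (u * dot (x i) (x j))) \<le> R ^ d"
    by simp
  then have "pair_avg (cube d) (\<lambda>x y. exp (u * dot x y)) k \<le> R ^ d / (2 ^ d) ^ k"
    by (simp add: pair_avg_def divide_right_mono)
  also have "\<dots> = rad_avg k (\<lambda>S. exp (u * ((S ^ 2 - real k) / 2))) ^ d"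
    by (simp add: R_def power_mult_distrib power_mult[symmetric] mult.commute[of d k])
  finally show ?thesis .
qed

section \<open>Hidden coordinates as a discrete heat flow\<close>

text \<open>The mean of \<open>V (K + h * S)\<close> for a sum \<open>S\<close> of \<open>m\<close>
  random signs, that is, the conditional weight of a pair with \<open>m\<close> coordinates
  hidden.\<close>

primrec heat :: "real \<Rightarrow> (real \<Rightarrow> real) \<Rightarrow> nat \<Rightarrow> real \<Rightarrow> real" where
  "heat h V 0 = V"
| "heat h V (Suc m) = (\<lambda>K. (heat h V m (K + h) + heat h V m (K - h)) / 2)"

text \<open>\<open>ln V\<close> is Lipschitz with constant \<open>l\<close>. The multiplicative form
  is linear in \<open>V\<close>, so it survives averaging over translates.\<close>

definition log_lipschitz :: "real \<Rightarrow> (real \<Rightarrow> real) \<Rightarrow> bool" where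
  "log_lipschitz l V \<longleftrightarrow> (\<forall>x. 0 < V x) \<and> (\<forall>x y. V x \<le> exp (l * \<bar>x - y\<bar>) * V y)"

lemma log_lipschitz_heat:
  assumes "log_lipschitz l V"
  shows "log_lipschitz l (heat h V m)"
proof (induction m)
  case (Suc m)
  let ?V = "heat h V m"
  have pos: "?V x > 0" and lip: "?V x \<le> exp (l * \<bar>x - y\<bar>) * ?V y" for x y
    using Suc by (auto simp: log_lipschitz_def)
  show ?case
    unfolding log_lipschitz_def
  proof (intro conjI allI)
    fix x y
    show "0 < heat h V (Suc m) x" using pos[of "x + h"] pos[of "x - h"] by simp
    have "?V (x + h) \<le> exp (l * \<bar>x - y\<bar>) * ?V (y + h)" "?V (x - h) \<le> exp (l * \<bar>x - y\<bar>) * ?V (y - h)"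
      using lip[of "x + h" "y + h"] lip[of "x - h" "y - h"] by simp_all
    then show "heat h V (Suc m) x \<le> exp (l * \<bar>x - y\<bar>) * heat h V (Suc m) y"
      by (simp add: distrib_left)
  qed
qed (use assms in simp)

text \<open>Turns the extremal factors in \<open>heat_step_le\<close> into exponentials, whose
  product over pairs depends only on the pair sum.\<close>

lemma one_plus_tanh_sign:
  assumes "x \<in> {-1, 1::real}"
  shows "1 + tanh u * x = exp (u * x) / cosh u"
proof -
  have "cosh u \<noteq> 0" using cosh_real_pos[of u] by simp
  then have "1 + tanh u * x = (cosh u + sinh u * x) / cosh u" by (simp add: tanh_def field_simps)
  also have "cosh u + sinh u * x = exp (u * x)"
    using assms by (auto simp: cosh_plus_sinh cosh_minus_sinh)
  finally show ?thesis .
qed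

text \<open>On signs, \<open>V (K e + h * z)\<close> is exactly its mean times
  \<open>1 + \<alpha> e * z\<close>. The Lipschitz bound gives
  \<open>\<bar>\<alpha> e\<bar> \<le> tanh (l * h)\<close>, and \<open>sum_signs_prod_mono\<close>
  replaces every \<open>\<alpha> e\<close> by this value.\<close>

lemma heat_step_le:
  assumes V: "log_lipschitz l V" and h: "0 \<le> h"
  shows "(\<Sum>y\<in>PiE {..<k} (\<lambda>_. {-1, 1}). \<Prod>(i, j)\<in>pairs {..<k}. V (K (i, j) + h * (y i * y j)))
    \<le> (2 ^ k * rad_avg k (\<lambda>S. exp (l * h * ((S ^ 2 - real k) / 2))) / cosh (l * h) ^ card (pairs {..<k}))
        * (\<Prod>e\<in>pairs {..<k}. (V (K e + h) + V (K e - h)) / 2)"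
proof -
  let ?X = "PiE {..<k} (\<lambda>_. {-1, 1::real})" and ?P = "pairs {..<k}"
  define A where "A e = V (K e + h)" for e
  define B where "B e = V (K e - h)" for e
  define \<alpha> where "\<alpha> e = (A e - B e) / (A e + B e)" for e
  define \<epsilon> where "\<epsilon> = exp (- (2 * (l * h)))"
  have pos: "A e > 0" "B e > 0" for e using V by (auto simp: A_def B_def log_lipschitz_def)
  have AB: "\<epsilon> * A e \<le> B e" "\<epsilon> * B e \<le> A e" for e
  proof -
    have "V x \<le> exp (2 * (l * h)) * V y" if "\<bar>x - y\<bar> = 2 * h" for x y
      using V that unfolding log_lipschitz_def by (metis mult.left_commute)
    from this[of "K e + h" "K e - h"] this[of "K e - h" "K e + h"]
    have "A e \<le> exp (2 * (l * h)) * B e" "B e \<le> exp (2 * (l * h)) * A e"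
      using h by (auto simp: A_def B_def)
    then show "\<epsilon> * A e \<le> B e" "\<epsilon> * B e \<le> A e"
      by (auto simp: \<epsilon>_def exp_minus field_simps)
  qed
  have tanh: "tanh (l * h) = (1 - \<epsilon>) / (1 + \<epsilon>)"
    by (simp add: tanh_real_altdef \<epsilon>_def)
  have \<alpha>: "\<bar>\<alpha> e\<bar> \<le> tanh (l * h)" for e
  proof -
    have "\<epsilon> > 0" by (simp add: \<epsilon>_def)
    then show ?thesis
      unfolding \<alpha>_def tanh abs_le_iff
      using AB[of e] pos[of e] by (auto simp: field_simps)
  qed
  have V_eq: "V (K e + h * z) = (A e + B e) / 2 * (1 + \<alpha> e * z)" if "z \<in> {-1, 1}" for e z
    using that pos[of e] by (auto simp: A_def B_def \<alpha>_def field_simps)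
  have sgn: "y i * y j \<in> {-1, 1}" if "y \<in> ?X" "(i, j) \<in> ?P" for y i j
    using PiE_mem[OF that(1), of i] PiE_mem[OF that(1), of j] that(2) by (auto simp: pairs_def)
  have M0: "0 \<le> (\<Prod>e\<in>?P. (A e + B e) / 2)"
    by (intro prod_nonneg divide_nonneg_nonneg add_nonneg_nonneg less_imp_le[OF pos(1)] less_imp_le[OF pos(2)]) simp
  have "(\<Sum>y\<in>?X. \<Prod>(i, j)\<in>?P. V (K (i, j) + h * (y i * y j))) =
      (\<Sum>y\<in>?X. \<Prod>(i, j)\<in>?P. (A (i, j) + B (i, j)) / 2 * (1 + \<alpha> (i, j) * (y i * y j)))"
  proof (intro sum.cong prod.cong refl)
    fix y e assume "y \<in> ?X" "e \<in> ?P"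
    then show "(case e of (i, j) \<Rightarrow> V (K (i, j) + h * (y i * y j))) =
        (case e of (i, j) \<Rightarrow> (A (i, j) + B (i, j)) / 2 * (1 + \<alpha> (i, j) * (y i * y j)))"
      using V_eq sgn by (cases e) simp
  qed
  also have "\<dots> = (\<Prod>e\<in>?P. (A e + B e) / 2) * (\<Sum>y\<in>?X. \<Prod>(i, j)\<in>?P. 1 + \<alpha> (i, j) * (y i * y j))"
    by (simp only: case_prod_unfold prod.distrib sum_distrib_left prod.collapse)
  also have "\<dots> \<le> (\<Prod>e\<in>?P. (A e + B e) / 2) * (\<Sum>y\<in>?X. \<Prod>(i, j)\<in>?P. 1 + tanh (l * h) * (y i * y j))"
    by (intro mult_left_mono sum_signs_prod_mono \<alpha> M0)
  also have "(\<Sum>y\<in>?X. \<Prod>(i, j)\<in>?P. 1 + tanh (l * h) * (y i * y j)) =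
      (\<Sum>y\<in>?X. exp (l * h * (\<Sum>(i, j)\<in>?P. y i * y j)) / cosh (l * h) ^ card ?P)"
  proof (intro sum.cong refl)
    fix y assume y: "y \<in> ?X"
    have "(\<Prod>(i, j)\<in>?P. 1 + tanh (l * h) * (y i * y j)) = (\<Prod>(i, j)\<in>?P. exp (l * h * (y i * y j)) / cosh (l * h))"
    proof (intro prod.cong refl)
      fix e assume "e \<in> ?P"
      then show "(case e of (i, j) \<Rightarrow> 1 + tanh (l * h) * (y i * y j)) =
          (case e of (i, j) \<Rightarrow> exp (l * h * (y i * y j)) / cosh (l * h))"
        using one_plus_tanh_sign sgn[OF y] by (cases e) simp
    qed
    then show "(\<Prod>(i, j)\<in>?P. 1 + tanh (l * h) * (y i * y j)) =
        exp (l * h * (\<Sum>(i, j)\<in>?P. y i * y j)) / cosh (l * h) ^ card ?P"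
      by (simp add: case_prod_unfold prod_dividef exp_sum sum_distrib_left)
  qed
  also have "\<dots> = 2 ^ k * rad_avg k (\<lambda>S. exp (l * h * ((S ^ 2 - real k) / 2))) / cosh (l * h) ^ card ?P"
    by (simp only: sum_divide_distrib[symmetric] sum_exp_pairs_eq_rad_avg)
  finally show ?thesis by (simp add: A_def B_def mult.commute)
qed

lemma pair_avg_cube_heat:
  assumes V: "log_lipschitz l V" and h: "0 \<le> h"
  shows "pair_avg (cube d) (\<lambda>x y. V (h * dot x y)) k
    \<le> (rad_avg k (\<lambda>S. exp (l * h * ((S ^ 2 - real k) / 2))) / cosh (l * h) ^ card (pairs {..<k})) ^ d
        * heat h V d 0 ^ card (pairs {..<k})"
proof -
  let ?P = "pairs {..<k}"
  define Q where "Q = rad_avg k (\<lambda>S. exp (l * h * ((S ^ 2 - real k) / 2))) / cosh (l * h) ^ card ?P"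
  define R where "R = 2 ^ k * Q"
  have R_eq: "R = 2 ^ k * rad_avg k (\<lambda>S. exp (l * h * ((S ^ 2 - real k) / 2))) / cosh (l * h) ^ card ?P"
    by (simp add: R_def Q_def)
  have R0: "R \<ge> 0"
    unfolding R_eq sum_exp_pairs_eq_rad_avg[symmetric]
    by (intro divide_nonneg_nonneg sum_nonneg zero_le_power) auto
  have "(\<Sum>x\<in>PiE {..<k} (\<lambda>_. cube d). \<Prod>(i, j)\<in>?P. heat h V 0 ((\<lambda>e. 0) (i, j) + h * dot (x i) (x j)))
      \<le> R ^ d * (\<Prod>e\<in>?P. heat h V d ((\<lambda>e. 0) e))"
  proof (rule sum_cube_le[OF R0])
    fix m :: nat and K :: "nat \<times> nat \<Rightarrow> real"
    show "(\<Sum>y\<in>PiE {..<k} (\<lambda>_. {-1, 1}). \<Prod>(i, j)\<in>?P. heat h V m (K (i, j) + h * (y i * y j)))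
      \<le> R * (\<Prod>e\<in>?P. heat h V (Suc m) (K e))"
      using heat_step_le[OF log_lipschitz_heat[OF V, of h m] h, where k = k and K = K] by (simp add: R_eq)
  qed
  then have "(\<Sum>x\<in>PiE {..<k} (\<lambda>_. cube d). \<Prod>(i, j)\<in>?P. V (h * dot (x i) (x j))) \<le> R ^ d * heat h V d 0 ^ card ?P"
    by simp
  then have "pair_avg (cube d) (\<lambda>x y. V (h * dot x y)) k \<le> R ^ d * heat h V d 0 ^ card ?P / (2 ^ d) ^ k"
    by (simp add: pair_avg_def divide_right_mono)
  also have "\<dots> = Q ^ d * heat h V d 0 ^ card ?P"
    by (simp add: R_def power_mult_distrib power_mult[symmetric] mult.commute[of d k])
  finally show ?thesis by (simp add: Q_def)
qed

subsection \<open>The connection probability\<close>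

text \<open>For a standard normal \<open>K\<close> the factor
  \<open>exp (- (s ^ 2 / 2) - s * K)\<close> has mean 1, so the edge density is about
  \<open>p\<close>. The minimum caps the kernel at \<open>q\<close>, which for \<open>q < 1\<close>
  keeps the complement positive and its logarithm Lipschitz.\<close>

definition kernel :: "real \<Rightarrow> real \<Rightarrow> real \<Rightarrow> real \<Rightarrow> real" where
  "kernel p q s K = p * exp (min (- (s ^ 2 / 2) - s * K) (ln (q / p)))"

lemma kernel_pos: "0 < p \<Longrightarrow> 0 < kernel p q s K"
  by (simp add: kernel_def)

lemma kernel_le:
  assumes "0 < p" and "0 < q"
  shows "kernel p q s K \<le> q"
proof -
  have "kernel p q s K \<le> p * exp (ln (q / p))"
    unfolding kernel_def using assms by (intro mult_left_mono iffD2[OF exp_le_cancel_iff]) auto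
  then show ?thesis using assms by simp
qed

text \<open>Dropping the cap only raises the weight, which becomes a multiple of
  \<open>exp (u * dot x y)\<close> with \<open>u = - (s / t)\<close>; the negative sign of
  \<open>u\<close> makes the cubic chaos term a gain. With \<open>t ^ 2\<close> coordinates,
  \<open>dot x y / t\<close> has variance 1.\<close>

lemma pair_avg_kernel_clique:
  assumes p: "0 < p" and s: "0 < s" "s \<le> 1 / 4" and t: "0 < t"
  shows "pair_avg (cube (t ^ 2)) (\<lambda>x y. kernel p q s (1 / real t * dot x y)) t
    \<le> exp (real t * (real t - 1) / 2 * ln p - s ^ 3 * ((real t - 1) * (real t - 2) / 6)
         + 12288 * s ^ 4 * real t ^ 2)"
proof -
  let ?N = "card (pairs {..<t})"
  define u where "u = - (s / real t)"
  define c where "c = exp (ln p - s ^ 2 / 2)"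
  define E where "E = u ^ 2 * (real t * (real t - 1) / 4) + u ^ 3 * (real t * (real t - 1) * (real t - 2) / 6)
         + 12288 * (u * real t) ^ 4"
  have tpos: "real t > 0" using t by simp
  have "pair_avg (cube (t ^ 2)) (\<lambda>x y. kernel p q s (1 / real t * dot x y)) t \<le>
      pair_avg (cube (t ^ 2)) (\<lambda>x y. c * exp (u * dot x y)) t"
  proof (rule pair_avg_mono)
    fix x y
    show "0 \<le> kernel p q s (1 / real t * dot x y)" using kernel_pos[OF p] by (rule less_imp_le)
    have "kernel p q s (1 / real t * dot x y) \<le> p * exp (- (s ^ 2 / 2) - s * (1 / real t * dot x y))"
      unfolding kernel_def using p by (intro mult_left_mono) auto
    also have "\<dots> = c * exp (u * dot x y)"
    proof -
      have "- (s ^ 2 / 2) - s * (1 / real t * dot x y) = - (s ^ 2 / 2) + u * dot x y"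
        by (simp add: u_def)
      moreover have "c = p * exp (- (s ^ 2 / 2))"
        by (simp only: c_def diff_conv_add_uminus exp_add exp_ln[OF p])
      ultimately show ?thesis by (simp only: exp_add mult.assoc)
    qed
    finally show "kernel p q s (1 / real t * dot x y) \<le> c * exp (u * dot x y)" .
  qed
  also have "\<dots> = c ^ ?N * pair_avg (cube (t ^ 2)) (\<lambda>x y. exp (u * dot x y)) t"
    by (rule pair_avg_cmult)
  also have "\<dots> \<le> c ^ ?N * exp E ^ (t ^ 2)"
  proof (intro mult_left_mono)
    have "pair_avg (cube (t ^ 2)) (\<lambda>x y. exp (u * dot x y)) t
        \<le> rad_avg t (\<lambda>S. exp (u * ((S ^ 2 - real t) / 2))) ^ (t ^ 2)"
      by (rule pair_avg_cube_exp)
    also have "\<dots> \<le> exp E ^ (t ^ 2)"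
    proof (rule power_mono)
      show "rad_avg t (\<lambda>S. exp (u * ((S ^ 2 - real t) / 2))) \<le> exp E"
        unfolding E_def by (rule rad_avg_exp_chaos) (use s tpos in \<open>simp add: u_def\<close>)
      show "0 \<le> rad_avg t (\<lambda>S. exp (u * ((S ^ 2 - real t) / 2)))"
        by (rule rad_avg_nonneg) simp
    qed
    finally show "pair_avg (cube (t ^ 2)) (\<lambda>x y. exp (u * dot x y)) t \<le> exp E ^ (t ^ 2)" .
  qed (simp add: c_def)
  also have "\<dots> = exp (real ?N * (ln p - s ^ 2 / 2) + real t ^ 2 * E)"
    by (simp add: c_def exp_add flip: exp_of_nat_mult)
  also have "real ?N * (ln p - s ^ 2 / 2) + real t ^ 2 * E =
      real t * (real t - 1) / 2 * ln p - s ^ 3 * ((real t - 1) * (real t - 2) / 6) + 12288 * s ^ 4 * real t ^ 2"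
  proof -
    \<comment> \<open>This term cancels exactly against the normalisation \<open>- s ^ 2 / 2\<close>
      summed over all pairs.\<close>
    have 1: "real t ^ 2 * (u ^ 2 * (real t * (real t - 1) / 4)) = real t * (real t - 1) / 2 * (s ^ 2 / 2)"
      using tpos by (simp add: u_def power_divide)
    have 2: "real t ^ 2 * (u ^ 3 * (real t * (real t - 1) * (real t - 2) / 6)) = - (s ^ 3 * ((real t - 1) * (real t - 2) / 6))"
      using tpos by (simp add: u_def power_divide power3_eq_cube power2_eq_square)
    have 3: "u * real t = - s" using tpos by (simp add: u_def)
    have "real t ^ 2 * E = real t * (real t - 1) / 2 * (s ^ 2 / 2) - s ^ 3 * ((real t - 1) * (real t - 2) / 6) + 12288 * s ^ 4 * real t ^ 2"
      unfolding E_def distrib_left 1 2 3 by simp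
    then show ?thesis unfolding card_pairs_lessThan by (simp add: right_diff_distrib)
  qed
  finally show ?thesis .
qed

text \<open>The logarithm of the kernel is Lipschitz with constant \<open>s\<close>, and
  \<open>ln (1 - w)\<close> has derivative \<open>- w / (1 - w)\<close> with respect to
  \<open>ln w\<close>, where \<open>w \<le> q\<close>.\<close>

lemma log_lipschitz_kernel_compl:
  assumes p: "0 < p" and q: "0 < q" "q < 1" and s: "0 < s"
  shows "log_lipschitz (s * (q / (1 - q))) (\<lambda>K. 1 - kernel p q s K)"
  unfolding log_lipschitz_def
proof (intro conjI allI)
  fix x y
  show "0 < 1 - kernel p q s x" using kernel_le[OF p q(1), of s x] q by simp
  define a where "a = kernel p q s x"
  define b where "b = kernel p q s y"
  define \<delta> where "\<delta> = s * \<bar>x - y\<bar>"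
  have b: "0 < b" "b \<le> q" using kernel_pos[OF p, of q s y] kernel_le[OF p q(1), of s y] by (auto simp: b_def)
  have \<delta>0: "\<delta> \<ge> 0" using s by (simp add: \<delta>_def)
  have "\<bar>s * x - s * y\<bar> = \<delta>" using s by (simp add: \<delta>_def abs_mult flip: right_diff_distrib)
  then have "min (- (s ^ 2 / 2) - s * y) (ln (q / p)) - \<delta> \<le> min (- (s ^ 2 / 2) - s * x) (ln (q / p))"
    using \<delta>0 by linarith
  then have "p * exp (min (- (s ^ 2 / 2) - s * y) (ln (q / p)) + - \<delta>) \<le> a"
    unfolding a_def kernel_def using p by (intro mult_left_mono iffD2[OF exp_le_cancel_iff]) auto
  then have ab: "b * exp (- \<delta>) \<le> a"
    by (simp only: exp_add b_def kernel_def mult.assoc)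
  have "1 - a \<le> 1 - b * exp (- \<delta>)" using ab by simp
  also have "\<dots> \<le> 1 - b * (1 - \<delta>)"
    using b exp_ge_add_one_self[of "- \<delta>"] by simp
  also have "\<dots> = (1 - b) * (1 + b / (1 - b) * \<delta>)"
    using b q by (simp add: field_simps)
  also have "\<dots> \<le> (1 - b) * (1 + q / (1 - q) * \<delta>)"
    using b q \<delta>0 by (intro mult_left_mono add_left_mono mult_right_mono frac_le) auto
  also have "\<dots> \<le> (1 - b) * exp (q / (1 - q) * \<delta>)"
    using b q by (intro mult_left_mono exp_ge_add_one_self) auto
  finally show "1 - kernel p q s x \<le> exp (s * (q / (1 - q)) * \<bar>x - y\<bar>) * (1 - kernel p q s y)"
    by (simp add: a_def b_def \<delta>_def mult_ac)
qed

text \<open>Exponentials are eigenfunctions of the averaging step: \<open>exp (- (c * K))\<close> is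
  multiplied by \<open>cosh (c * h)\<close>.\<close>

lemma heat_le_exponentials:
  assumes "\<And>K. V K \<le> 1 - c1 * exp (- (s * K)) + c2 * exp (- K)"
  shows "heat h V m K \<le> 1 - c1 * cosh (s * h) ^ m * exp (- (s * K)) + c2 * cosh h ^ m * exp (- K)"
proof (induction m arbitrary: K)
  case 0
  then show ?case using assms by simp
next
  case (Suc m)
  have e: "(exp (- (c * (K + h))) + exp (- (c * (K - h)))) / 2 = cosh (c * h) * exp (- (c * K))" for c
    by (simp add: cosh_field_def algebra_simps flip: exp_add)
  have "heat h V (Suc m) K \<le> ((1 - c1 * cosh (s * h) ^ m * exp (- (s * (K + h))) + c2 * cosh h ^ m * exp (- (K + h))) +
      (1 - c1 * cosh (s * h) ^ m * exp (- (s * (K - h))) + c2 * cosh h ^ m * exp (- (K - h)))) / 2"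
    unfolding heat.simps by (intro divide_right_mono add_mono Suc.IH) simp
  also have "\<dots> = 1 - c1 * cosh (s * h) ^ m * ((exp (- (s * (K + h))) + exp (- (s * (K - h)))) / 2)
      + c2 * cosh h ^ m * ((exp (- (1 * (K + h))) + exp (- (1 * (K - h)))) / 2)"
    by (simp add: field_simps)
  also have "\<dots> = 1 - c1 * cosh (s * h) ^ Suc m * exp (- (s * K)) + c2 * cosh h ^ Suc m * exp (- K)"
    unfolding e by (simp add: mult_ac)
  finally show ?case .
qed

text \<open>The uncapped kernel has mean at least \<open>p * (1 - s ^ 4)\<close>. What the cap
  removes is dominated by a multiple of \<open>exp (- K)\<close>, whose mean is at most
  \<open>p * s ^ 4\<close> by \<open>tail\<close>.\<close>

lemma heat_kernel_compl_le:
  assumes p: "0 < p" "p \<le> 1 / 2" and q: "p < q" "q < 1" and s: "0 < s" "s \<le> 1" and t: "0 < t"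
    and tail: "exp (1 / 2 + ln (q / p) - ln (q / p) / s) \<le> s ^ 4"
  shows "heat (1 / real t) (\<lambda>K. 1 - kernel p q s K) (t ^ 2) 0 \<le> (1 - p) * exp (2 * s ^ 4)"
proof -
  define \<eta> where "\<eta> = ln (q / p)"
  define c1 where "c1 = p * exp (- (s ^ 2 / 2))"
  define c2 where "c2 = p * exp (\<eta> - \<eta> / s)"
  have tpos: "real t \<ge> 1" using t by simp
  have \<eta>0: "\<eta> > 0" using p q by (simp add: \<eta>_def)
  have "1 - kernel p q s K \<le> 1 - c1 * exp (- (s * K)) + c2 * exp (- K)" for K
  proof -
    define y where "y = - (s ^ 2 / 2) - s * K"
    have "exp y - exp (\<eta> - \<eta> / s - K) \<le> exp (min y \<eta>)"
    proof (cases "y \<le> \<eta>")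
      case True
      then show ?thesis by (simp add: min_absorb1)
    next
      case False
      \<comment> \<open>Above the cap, \<open>s \<le> 1\<close> allows dividing the excess
        \<open>y - \<eta>\<close> by \<open>s\<close>. This turns the rate \<open>s\<close> in
        \<open>K\<close> into rate 1 and gains the factor \<open>exp (\<eta> - \<eta> / s)\<close>,
        tiny for small \<open>s\<close>.\<close>
      have "(y - \<eta>) \<le> (y - \<eta>) / s" using False s by (simp add: pos_le_divide_eq mult_left_le)
      also have "\<dots> = - (s / 2) - K - \<eta> / s"
        using s by (simp add: y_def field_simps power2_eq_square)
      also have "\<dots> \<le> - K - \<eta> / s" using s by simp
      finally have "exp y \<le> exp (\<eta> - \<eta> / s - K)" by simp
      then show ?thesis using exp_ge_zero[of "min y \<eta>"] by linarith
    qed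
    then have "p * (exp y - exp (\<eta> - \<eta> / s - K)) \<le> kernel p q s K"
      unfolding kernel_def y_def \<eta>_def using p by (intro mult_left_mono) auto
    moreover have "p * (exp y - exp (\<eta> - \<eta> / s - K)) = c1 * exp (- (s * K)) - c2 * exp (- K)"
    proof -
      have "exp y = exp (- (s ^ 2 / 2)) * exp (- (s * K))" by (simp add: y_def flip: exp_add)
      moreover have "exp (\<eta> - \<eta> / s - K) = exp (\<eta> - \<eta> / s) * exp (- K)" by (simp flip: exp_add)
      ultimately show ?thesis by (simp add: c1_def c2_def right_diff_distrib)
    qed
    ultimately show ?thesis by simp
  qed
  from heat_le_exponentials[where V = "\<lambda>K. 1 - kernel p q s K", OF this, where h = "1 / real t" and m = "t ^ 2" and K = 0]
  have 1: "heat (1 / real t) (\<lambda>K. 1 - kernel p q s K) (t ^ 2) 0 \<le>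
      1 - c1 * cosh (s * (1 / real t)) ^ t ^ 2 + c2 * cosh (1 / real t) ^ t ^ 2" by simp
  have 2: "exp (s ^ 2 / 2) * (1 - s ^ 4) \<le> cosh (s * (1 / real t)) ^ t ^ 2"
  proof -
    have "s \<le> real t" using s tpos by linarith
    then have "exp ((s / real t) ^ 2 / 2 - (s / real t) ^ 4 / 4) \<le> cosh (s / real t)"
      using s tpos by (intro cosh_ge_exp) (simp add: field_simps)
    then have "exp ((s / real t) ^ 2 / 2 - (s / real t) ^ 4 / 4) ^ t ^ 2 \<le> cosh (s / real t) ^ t ^ 2"
      by (intro power_mono) auto
    moreover have "exp ((s / real t) ^ 2 / 2 - (s / real t) ^ 4 / 4) ^ t ^ 2 = exp (s ^ 2 / 2 - s ^ 4 / (4 * real t ^ 2))"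
      using tpos by (simp add: field_simps eval_nat_numeral flip: exp_of_nat_mult)
    moreover have "exp (s ^ 2 / 2) * (1 - s ^ 4) \<le> exp (s ^ 2 / 2 - s ^ 4 / (4 * real t ^ 2))"
    proof -
      have "s ^ 4 / (4 * real t ^ 2) \<le> s ^ 4 / 1"
      proof (rule divide_left_mono)
        show "1 \<le> 4 * real t ^ 2" using one_le_power[OF tpos, of 2] by linarith
      qed (use tpos in auto)
      then have "1 - s ^ 4 \<le> 1 + - (s ^ 4 / (4 * real t ^ 2))" by simp
      also have "\<dots> \<le> exp (- (s ^ 4 / (4 * real t ^ 2)))" by (rule exp_ge_add_one_self)
      finally have "exp (s ^ 2 / 2) * (1 - s ^ 4) \<le> exp (s ^ 2 / 2) * exp (- (s ^ 4 / (4 * real t ^ 2)))"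
        by (intro mult_left_mono) auto
      then show ?thesis by (simp flip: exp_add)
    qed
    ultimately show ?thesis by simp
  qed
  have 3: "cosh (1 / real t) ^ t ^ 2 \<le> exp (1 / 2)"
  proof -
    have "cosh (1 / real t) ^ t ^ 2 \<le> exp ((1 / real t) ^ 2 / 2) ^ t ^ 2"
      by (intro power_mono cosh_le_exp_half_square) auto
    also have "\<dots> = exp (1 / 2)"
      using tpos by (simp add: field_simps flip: exp_of_nat_mult)
    finally show ?thesis .
  qed
  have "c1 * (exp (s ^ 2 / 2) * (1 - s ^ 4)) \<le> c1 * cosh (s * (1 / real t)) ^ t ^ 2"
    using 2 p by (intro mult_left_mono) (auto simp: c1_def)
  moreover have "c1 * (exp (s ^ 2 / 2) * (1 - s ^ 4)) = p * (1 - s ^ 4)"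
    by (simp add: c1_def exp_minus field_simps)
  moreover have "c2 * cosh (1 / real t) ^ t ^ 2 \<le> c2 * exp (1 / 2)"
    using 3 p by (intro mult_left_mono) (auto simp: c2_def)
  moreover have "c2 * exp (1 / 2) = p * exp (1 / 2 + ln (q / p) - ln (q / p) / s)"
    by (simp add: c2_def \<eta>_def exp_add exp_diff)
  moreover have "p * exp (1 / 2 + ln (q / p) - ln (q / p) / s) \<le> p * s ^ 4"
    using tail p by (intro mult_left_mono) auto
  ultimately have "heat (1 / real t) (\<lambda>K. 1 - kernel p q s K) (t ^ 2) 0 \<le> 1 - p + p * (2 * s ^ 4)"
    using 1 by (simp add: algebra_simps)
  \<comment> \<open>Here \<open>p \<le> 1 / 2\<close> makes the error relative to
    \<open>1 - p\<close>.\<close>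
  also have "\<dots> \<le> 1 - p + (1 - p) * (2 * s ^ 4)"
    using p by (intro add_left_mono mult_right_mono) auto
  also have "\<dots> = (1 - p) * (1 + 2 * s ^ 4)" by (simp add: algebra_simps)
  also have "\<dots> \<le> (1 - p) * exp (2 * s ^ 4)"
    using p by (intro mult_left_mono exp_ge_add_one_self) auto
  finally show ?thesis .
qed

text \<open>In \<open>pair_avg_cube_heat\<close> with Lipschitz constant \<open>s * \<rho>\<close>,
  the quadratic part of the chaos estimate cancels against the power of cosh, so only the cubic term
  and quartic errors remain besides the density factor.\<close>

lemma pair_avg_kernel_indep:
  assumes p: "0 < p" "p \<le> 1 / 2" and q: "p < q" "q < 1" and s: "0 < s" "s \<le> 1 / 4" and t: "0 < t"
    and \<rho>: "\<rho> = q / (1 - q)" "\<rho> \<le> 1" and k: "k \<le> t"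
    and tail: "exp (1 / 2 + ln (q / p) - ln (q / p) / s) \<le> s ^ 4"
  shows "pair_avg (cube (t ^ 2)) (\<lambda>x y. 1 - kernel p q s (1 / real t * dot x y)) k
    \<le> exp (real k * (real k - 1) / 2 * (ln (1 - p) + 2 * s ^ 4)
         + real t ^ 2 * ((s * \<rho> * (real k / real t)) ^ 3 / 6 + 12289 * s ^ 4))"
proof -
  let ?N = "card (pairs {..<k})"
  let ?V = "\<lambda>K. 1 - kernel p q s K"
  define u where "u = s * \<rho> * (1 / real t)"
  have tpos: "real t \<ge> 1" using t by simp
  have \<rho>0: "\<rho> > 0" using p q by (simp add: \<rho>)
  have u0: "u \<ge> 0" using s \<rho>0 by (simp add: u_def)
  have kt: "real k / real t \<le> 1" using k tpos by simp
  have uk: "u * real k = s * \<rho> * (real k / real t)" by (simp add: u_def)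
  have uk_le: "u * real k \<le> s"
  proof -
    have "\<rho> * (real k / real t) \<le> 1 * 1" using \<rho> \<rho>0 kt by (intro mult_mono) auto
    then have "s * (\<rho> * (real k / real t)) \<le> s * 1" using s by (intro mult_left_mono) auto
    then show ?thesis by (simp add: uk mult.assoc)
  qed
  have u1: "\<bar>u\<bar> \<le> 1"
  proof -
    have "s * \<rho> \<le> 1 * 1" using s \<rho> \<rho>0 by (intro mult_mono) auto
    then show ?thesis using tpos u0 by (simp add: u_def field_simps)
  qed
  have lip: "log_lipschitz (s * \<rho>) ?V"
    unfolding \<rho> using log_lipschitz_kernel_compl p q s by simp
  have heat: "heat (1 / real t) ?V (t ^ 2) 0 \<le> exp (ln (1 - p) + 2 * s ^ 4)"
    using heat_kernel_compl_le[OF p q _ _ t tail] s p by (simp add: exp_add)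
  have heat0: "heat (1 / real t) ?V (t ^ 2) 0 \<ge> 0"
    using log_lipschitz_heat[OF lip, of "1 / real t" "t ^ 2"] by (simp add: log_lipschitz_def less_imp_le)
  define Q where "Q = rad_avg k (\<lambda>S. exp (u * ((S ^ 2 - real k) / 2))) / cosh u ^ ?N"
  have Q0: "Q \<ge> 0"
    unfolding Q_def by (intro divide_nonneg_nonneg rad_avg_nonneg zero_le_power) auto
  have Q: "Q \<le> exp ((u * real k) ^ 3 / 6 + 12289 * s ^ 4)"
  proof -
    define E where "E = u ^ 2 * (real k * (real k - 1) / 4) + u ^ 3 * (real k * (real k - 1) * (real k - 2) / 6)
         + 12288 * (u * real k) ^ 4"
    have N: "real ?N = real k * (real k - 1) / 2" by (rule card_pairs_lessThan)
    have "rad_avg k (\<lambda>S. exp (u * ((S ^ 2 - real k) / 2))) \<le> exp E"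
      unfolding E_def by (rule rad_avg_exp_chaos) (use uk_le u0 s in simp)
    moreover have "exp (u ^ 2 / 2 - u ^ 4 / 4) ^ ?N \<le> cosh u ^ ?N"
      by (intro power_mono cosh_ge_exp u1) auto
    ultimately have "Q \<le> exp E / exp (u ^ 2 / 2 - u ^ 4 / 4) ^ ?N"
      unfolding Q_def by (intro frac_le) auto
    also have "\<dots> = exp (E - real ?N * (u ^ 2 / 2 - u ^ 4 / 4))"
      by (simp only: exp_diff[of E] exp_of_nat_mult)
    also have "\<dots> \<le> exp ((u * real k) ^ 3 / 6 + 12289 * s ^ 4)"
    proof -
      have a: "u ^ 3 * (real k * (real k - 1) * (real k - 2) / 6) \<le> (u * real k) ^ 3 / 6"
      proof -
        have "real k * (real k - 1) * (real k - 2) \<le> real k ^ 3"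
        proof (cases "k = 0")
          case False
          then have "real k * 2 \<le> 3 * (real k * real k)" by simp
          then have "real k * (3 * real k - 2) \<ge> 0" by (simp add: algebra_simps)
          then show ?thesis by (simp add: algebra_simps eval_nat_numeral)
        qed simp
        then have "u ^ 3 * (real k * (real k - 1) * (real k - 2)) \<le> u ^ 3 * real k ^ 3"
          using u0 by (intro mult_left_mono) auto
        then show ?thesis by (simp add: power_mult_distrib)
      qed
      have b: "real ?N * (u ^ 4 / 4) \<le> (u * real k) ^ 4"
      proof -
        have "real ?N \<le> real k ^ 4"
        proof (cases "k = 0")
          case False
          then have "real k ^ 2 \<le> real k ^ 4" by (intro power_increasing) auto
          moreover have "real k * (real k - 1) \<le> real k ^ 2" by (simp add: power2_eq_square algebra_simps)
          ultimately show ?thesis unfolding N using zero_le_power2[of "real k"] by linarith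
        qed (simp add: pairs_def)
        then have "real ?N * (u ^ 4 / 4) \<le> real k ^ 4 * (u ^ 4 / 4)"
          by (intro mult_right_mono) auto
        also have "\<dots> \<le> (u * real k) ^ 4" by (simp add: power_mult_distrib)
        finally show ?thesis .
      qed
      have c: "(u * real k) ^ 4 \<le> s ^ 4" using uk_le u0 by (intro power_mono) auto
      \<comment> \<open>The quadratic term of \<open>E\<close> is
        \<open>real ?N * (u ^ 2 / 2)\<close>. The constant 12289 is 12288 from the chaos remainder
        plus 1 for the quartic loss in the lower bound on cosh.\<close>
      have "E - real ?N * (u ^ 2 / 2 - u ^ 4 / 4) =
          u ^ 3 * (real k * (real k - 1) * (real k - 2) / 6) + 12288 * (u * real k) ^ 4 + real ?N * (u ^ 4 / 4)"
        unfolding E_def N by (simp add: field_simps)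
      then show ?thesis using a b c by simp
    qed
    finally show ?thesis .
  qed
  have "pair_avg (cube (t ^ 2)) (\<lambda>x y. ?V (1 / real t * dot x y)) k
      \<le> Q ^ t ^ 2 * heat (1 / real t) ?V (t ^ 2) 0 ^ ?N"
    unfolding Q_def u_def by (rule pair_avg_cube_heat[OF lip]) (use s \<rho>0 in auto)
  also have "\<dots> \<le> exp ((u * real k) ^ 3 / 6 + 12289 * s ^ 4) ^ t ^ 2 * exp (ln (1 - p) + 2 * s ^ 4) ^ ?N"
    using Q Q0 heat heat0 by (intro mult_mono power_mono) auto
  also have "\<dots> = exp (real ?N * (ln (1 - p) + 2 * s ^ 4) + real t ^ 2 * ((u * real k) ^ 3 / 6 + 12289 * s ^ 4))"
    unfolding exp_of_nat_mult[symmetric] of_nat_power exp_add[symmetric] by (simp only: add.commute)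
  finally show ?thesis unfolding card_pairs_lessThan uk .
qed

section \<open>The numerical inequality for \<open>p\<close> between 0.42 and 0.5\<close>

text \<open>Removes the logarithms: at a rational \<open>p\<close>, a bound on the ratio becomes a
  comparison of integer powers.\<close>

lemma log_ratio_less:
  assumes "0 < p" "p < (1::real)" and "(1 - p) ^ a < p ^ b" and "0 < b"
  shows "ln p / (2 * ln (1 - p)) < real a / (2 * real b)"
proof -
  have "ln ((1 - p) ^ a) < ln (p ^ b)"
    using assms by (intro ln_less_cancel_iff[THEN iffD2]) auto
  then have "real a * ln (1 - p) < real b * ln p"
    using assms by (simp add: ln_realpow)
  moreover have "ln (1 - p) < 0" using assms by simp
  ultimately show ?thesis using assms by (simp add: field_simps)
qed

text \<open>As \<open>p\<close> grows, \<kappa> decreases and \<open>p / (1 - p)\<close> increases.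
  On a short interval \<kappa> is bounded by a fraction \<open>a / (2 * b)\<close> valid at the left
  endpoint, and \<rho> is chosen from the right endpoint.\<close>

lemma log_ratio_bound:
  fixes p :: real
  assumes "0.42 < p" and "p < 0.5"
  shows "\<exists>\<rho>. p / (1 - p) < \<rho> \<and> \<rho> \<le> 1 \<and> (ln p / (2 * ln (1 - p)) * \<rho>) ^ 3 < 1 - ln p / (2 * ln (1 - p))"
proof -
  define \<kappa> where "\<kappa> = ln p / (2 * ln (1 - p))"
  have lns: "ln p < 0" "ln (1 - p) < 0" using assms by auto
  have \<kappa>0: "\<kappa> > 0" using lns by (simp add: \<kappa>_def zero_less_divide_iff)
  have main: "\<exists>\<rho>. p / (1 - p) < \<rho> \<and> \<rho> \<le> 1 \<and> (\<kappa> * \<rho>) ^ 3 < 1 - \<kappa>"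
    if lo: "l \<le> p" and l: "0 < l" and pow: "(1 - l) ^ a < l ^ b" and b: "0 < b"
      and r: "p < \<rho> * (1 - p)" "0 < \<rho>" "\<rho> \<le> 1" and fin: "(real a / (2 * real b) * \<rho>) ^ 3 < 1 - real a / (2 * real b)"
    for l \<rho> :: real and a b :: nat
  proof (intro exI conjI)
    show "p / (1 - p) < \<rho>" using r assms by (simp add: pos_divide_less_eq)
    show "\<rho> \<le> 1" by fact
    have "(1 - p) ^ a \<le> (1 - l) ^ a" using lo assms by (intro power_mono) auto
    also note pow
    also have "l ^ b \<le> p ^ b" using lo l by (intro power_mono) auto
    finally have \<kappa>: "\<kappa> < real a / (2 * real b)"
      unfolding \<kappa>_def using assms b by (intro log_ratio_less) auto
    have "(\<kappa> * \<rho>) ^ 3 \<le> (real a / (2 * real b) * \<rho>) ^ 3"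
      using \<kappa> \<kappa>0 r by (intro power_mono mult_right_mono) auto
    then show "(\<kappa> * \<rho>) ^ 3 < 1 - \<kappa>" using fin \<kappa> by linarith
  qed
  \<comment> \<open>The intervals are short near 0.42, where the margin is smallest. The chosen
    \<rho> exceeds \<open>p / (1 - p)\<close> at the right endpoint, except in the last case, where
    it is the value 1 at the excluded endpoint 0.5.\<close>
  consider "p \<le> 0.422" | "0.422 \<le> p" "p \<le> 0.428" | "0.428 \<le> p" "p \<le> 0.443"
    | "0.443 \<le> p" "p \<le> 0.48" | "0.48 \<le> p" by linarith
  then have "\<exists>\<rho>. p / (1 - p) < \<rho> \<and> \<rho> \<le> 1 \<and> (\<kappa> * \<rho>) ^ 3 < 1 - \<kappa>"
  proof cases
    case 1
    show ?thesis
      by (rule main[of "42/100" 8 5 "7305/10000"])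
        (use 1 assms in \<open>simp_all add: power_divide\<close>)
  next
    case 2
    show ?thesis
      by (rule main[of "422/1000" 19 12 "7487/10000"])
        (use 2 assms in \<open>simp_all add: power_divide\<close>)
  next
    case 3
    show ?thesis
      by (rule main[of "428/1000" 20 13 "797/1000"])
        (use 3 assms in \<open>simp_all add: power_divide\<close>)
  next
    case 4
    show ?thesis
      by (rule main[of "443/1000" 7 5 "94/100"])
        (use 4 assms in \<open>simp_all add: power_divide\<close>)
  next
    case 5
    show ?thesis
      by (rule main[of "48/100" 13 10 1])
        (use 5 assms in \<open>simp_all add: power_divide\<close>)
  qed
  then show ?thesis by (simp add: \<kappa>_def)
qed

subsection \<open>Optimising the exponent\<close>

lemma c_const_le:
  assumes "1 \<le> n" and "simple_graph E" and "\<not> contains_clique n E t"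
  shows "c_const s t \<le> indep_prob n E s"
  unfolding c_const_def
proof (rule cInf_lower)
  show "bdd_below {indep_prob n E s |n E. 1 \<le> n \<and> simple_graph E \<and> \<not> contains_clique n E t}"
    by (rule bdd_belowI[of _ 0]) (auto simp: indep_prob_def)
qed (use assms in blast)

text \<open>Maximise over \<open>y = k / t\<close>: the quadratic part peaks at \<open>y = \<kappa>\<close>, so to leading order the cubic
  perturbation need only be evaluated there.\<close>

lemma exponent_le:
  fixes y :: real
  assumes L: "0 < L" and a0: "0 \<le> a0" and \<kappa>: "\<kappa> = a0 / L" "\<kappa> \<le> 1" and \<rho>: "0 \<le> \<rho>" "\<rho> \<le> 1"
    and s: "0 \<le> s" and y: "0 \<le> y" "y \<le> 1"
  shows "(a0 + s ^ 3 / 6 - 12289 * s ^ 4) * y - L * y ^ 2 / 2 + (s * \<rho> * y) ^ 3 / 6 + 12290 * s ^ 4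
    \<le> (a0 + s ^ 3 / 6 - 12289 * s ^ 4) + (- a0 + a0 ^ 2 / (2 * L))
       - (s ^ 3 / 6 * (1 - \<kappa> - (\<kappa> * \<rho>) ^ 3) - 25000 * s ^ 4 - s ^ 6 / L)"
proof -
  define z where "z = y - \<kappa>"
  have \<kappa>0: "0 \<le> \<kappa>" using L a0 by (simp add: \<kappa>)
  have quad: "a0 * y - L * y ^ 2 / 2 = a0 ^ 2 / (2 * L) - L / 2 * z ^ 2"
    using L by (simp add: z_def \<kappa> power2_eq_square field_simps)
  have cube: "y ^ 3 - \<kappa> ^ 3 \<le> 3 * \<bar>z\<bar>"
  proof -
    have "y ^ 3 - \<kappa> ^ 3 = z * (y ^ 2 + y * \<kappa> + \<kappa> ^ 2)"
      by (simp add: z_def algebra_simps eval_nat_numeral)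
    also have "\<dots> \<le> \<bar>z\<bar> * (y ^ 2 + y * \<kappa> + \<kappa> ^ 2)"
      using y \<kappa>0 by (intro mult_right_mono) auto
    also have "\<dots> \<le> \<bar>z\<bar> * (1 + 1 * 1 + 1)"
      using y \<kappa> \<kappa>0 by (intro mult_left_mono add_mono mult_mono power_le_one) auto
    finally show ?thesis by simp
  qed
  have \<rho>3: "0 \<le> \<rho> ^ 3" "\<rho> ^ 3 \<le> 1" using \<rho> by (auto intro: power_le_one)
  have "\<rho> ^ 3 * (y ^ 3 - \<kappa> ^ 3) \<le> 3 * \<bar>z\<bar>"
  proof -
    have "\<rho> ^ 3 * (y ^ 3 - \<kappa> ^ 3) \<le> \<rho> ^ 3 * (3 * \<bar>z\<bar>)" using cube \<rho>3 by (intro mult_left_mono) auto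
    also have "\<dots> \<le> 1 * (3 * \<bar>z\<bar>)" using \<rho>3 by (intro mult_right_mono) auto
    finally show ?thesis by simp
  qed
  then have "\<rho> ^ 3 * y ^ 3 \<le> \<kappa> ^ 3 * \<rho> ^ 3 + 3 * \<bar>z\<bar>"
    by (simp add: right_diff_distrib mult.commute)
  moreover have "y \<le> \<kappa> + \<bar>z\<bar>" by (simp add: z_def)
  ultimately have "y + (\<rho> * y) ^ 3 \<le> \<kappa> + (\<kappa> * \<rho>) ^ 3 + 4 * \<bar>z\<bar>"
    unfolding power_mult_distrib by linarith
  then have "s ^ 3 / 6 * (y + (\<rho> * y) ^ 3) \<le> s ^ 3 / 6 * (\<kappa> + (\<kappa> * \<rho>) ^ 3 + 4 * \<bar>z\<bar>)"
    using s by (intro mult_left_mono) auto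
  then have pert: "s ^ 3 / 6 * y + (s * \<rho> * y) ^ 3 / 6 \<le> s ^ 3 / 6 * (\<kappa> + (\<kappa> * \<rho>) ^ 3) + 2 / 3 * s ^ 3 * \<bar>z\<bar>"
    by (simp add: power_mult_distrib algebra_simps)
  \<comment> \<open>The loss linear in \<open>\<bar>z\<bar>\<close> is absorbed by the curvature of
    the quadratic part, at a cost of sixth order in \<open>s\<close>.\<close>
  have amgm: "2 / 3 * s ^ 3 * \<bar>z\<bar> \<le> L / 2 * z ^ 2 + s ^ 6 / L"
  proof -
    have "0 \<le> (L * \<bar>z\<bar> - s ^ 3) ^ 2" by simp
    then have "2 * (L * (s ^ 3 * \<bar>z\<bar>)) \<le> L * (L * z ^ 2) + s ^ 6"
      by (simp add: power2_diff power_mult_distrib algebra_simps power2_eq_square flip: power_add)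
    then have "s ^ 3 * \<bar>z\<bar> \<le> L / 2 * z ^ 2 + s ^ 6 / L / 2"
      using L by (simp add: field_simps)
    moreover have "2 / 3 * s ^ 3 * \<bar>z\<bar> \<le> s ^ 3 * \<bar>z\<bar>" using s by (simp add: mult_right_mono)
    moreover have "s ^ 6 / L / 2 \<le> s ^ 6 / L" using s L by (simp add: field_simps)
    ultimately show ?thesis by linarith
  qed
  \<comment> \<open>The quartic errors add up to \<open>(12289 + 12290) * s ^ 4\<close>, rounded up
    to \<open>25000 * s ^ 4\<close>.\<close>
  have "(a0 + s ^ 3 / 6 - 12289 * s ^ 4) * y = a0 * y + s ^ 3 / 6 * y - 12289 * s ^ 4 * y"
    by (simp add: left_diff_distrib distrib_right)
  moreover have "s ^ 3 / 6 * (1 - \<kappa> - (\<kappa> * \<rho>) ^ 3) = s ^ 3 / 6 - s ^ 3 / 6 * (\<kappa> + (\<kappa> * \<rho>) ^ 3)"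
    by (simp add: right_diff_distrib distrib_left)
  moreover have "0 \<le> 12289 * s ^ 4 * y" "0 \<le> s ^ 4" using s y by auto
  ultimately show ?thesis using quad pert amgm by linarith
qed

theorem theorem1p2:
  fixes p :: real
  assumes "0.42 < p" and "p < 0.5"
  shows "\<exists>\<gamma>>0. \<exists>h. h \<in> o[at_top](\<lambda>t::nat. real t ^ 2) \<and>
    (\<forall>\<^sub>F t in at_top. c_const t t \<le>
       exp (((4 * ln (1 - p) - ln p) * ln p / (8 * ln (1 - p)) - \<gamma>) * real t ^ 2 + h t))"
proof -
  define L where "L = - ln (1 - p)"
  define a0 where "a0 = - ln p / 2"
  define \<kappa> where "\<kappa> = a0 / L"
  \<comment> \<open>The exponent of the statement at \<open>\<gamma> = 0\<close>.\<close>
  define f where "f = - a0 + a0 ^ 2 / (2 * L)"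
  have p: "0 < p" "p \<le> 1 / 2" using assms by auto
  have L: "L > 0" using assms by (simp add: L_def)
  have a0: "a0 > 0" using assms by (simp add: a0_def)
  have \<kappa>_eq: "\<kappa> = ln p / (2 * ln (1 - p))" using L by (simp add: \<kappa>_def a0_def L_def)
  have f_eq: "(4 * ln (1 - p) - ln p) * ln p / (8 * ln (1 - p)) = f"
    using L by (simp add: f_def a0_def L_def field_simps power2_eq_square)
  obtain \<rho> where \<rho>: "p / (1 - p) < \<rho>" "\<rho> \<le> 1" "(\<kappa> * \<rho>) ^ 3 < 1 - \<kappa>"
    using log_ratio_bound[OF assms] unfolding \<kappa>_eq by blast
  have \<rho>0: "\<rho> > 0" using \<rho>(1) p divide_pos_pos[of p "1 - p"] by linarith
  \<comment> \<open>Solves \<open>q / (1 - q) = \<rho>\<close>, which gives the Lipschitz constant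
    \<open>s * \<rho>\<close>; \<open>p < q\<close> follows from
    \<open>p / (1 - p) < \<rho>\<close>.\<close>
  define q where "q = \<rho> / (1 + \<rho>)"
  have "p < \<rho> * (1 - p)" using \<rho>(1) p by (simp add: pos_divide_less_eq)
  then have "p * (1 + \<rho>) < \<rho>" by (simp add: algebra_simps)
  then have q: "p < q" "q < 1" using \<rho>0 by (simp_all add: q_def pos_less_divide_eq)
  have "1 - q = 1 / (1 + \<rho>)" using \<rho>0 by (simp add: q_def field_simps)
  then have \<rho>_eq: "\<rho> = q / (1 - q)" using \<rho>0 by (simp add: q_def)
  define \<eta> where "\<eta> = ln (q / p)"
  have \<eta>: "\<eta> > 0" using p q by (simp add: \<eta>_def)
  define \<delta> where "\<delta> = 1 - \<kappa> - (\<kappa> * \<rho>) ^ 3"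
  have \<delta>: "\<delta> > 0" using \<rho> by (simp add: \<delta>_def)
  have \<kappa>0: "\<kappa> > 0" using a0 L by (simp add: \<kappa>_def)
  have \<kappa>\<rho>: "(\<kappa> * \<rho>) ^ 3 > 0" using \<kappa>0 \<rho>0 by simp
  have \<kappa>1: "\<kappa> \<le> 1" using \<delta> \<kappa>\<rho> unfolding \<delta>_def by linarith
  have \<delta>1: "\<delta> \<le> 1" using \<kappa>0 \<kappa>\<rho> unfolding \<delta>_def by linarith
  have "\<forall>\<^sub>F s in at_right 0. exp (1 / 2 + \<eta> - \<eta> / s) \<le> s ^ 4"
    using \<eta> by real_asymp
  moreover have "\<forall>\<^sub>F s in at_right 0. s ^ 3 / 6 * \<delta> - 25000 * s ^ 4 - s ^ 6 / L > 0"
    using \<delta> L by real_asymp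
  moreover have "\<forall>\<^sub>F s in at_right (0::real). s > 0 \<and> s \<le> 1 / 4"
    by (auto simp: eventually_at_right_field intro!: exI[of _ "1 / 4"])
  ultimately have "\<forall>\<^sub>F s in at_right 0. exp (1 / 2 + \<eta> - \<eta> / s) \<le> s ^ 4 \<and>
      s ^ 3 / 6 * \<delta> - 25000 * s ^ 4 - s ^ 6 / L > 0 \<and> s > 0 \<and> s \<le> 1 / 4"
    by eventually_elim auto
  \<comment> \<open>For small \<open>s\<close> the tail is below every power of \<open>s\<close>
    since \<open>\<eta> > 0\<close>, and the cubic gain beats the higher-order errors since
    \<open>\<delta> > 0\<close>.\<close>
  then obtain s where s: "exp (1 / 2 + \<eta> - \<eta> / s) \<le> s ^ 4"
      "s ^ 3 / 6 * \<delta> - 25000 * s ^ 4 - s ^ 6 / L > 0" "s > 0" "s \<le> 1 / 4"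
    using eventually_happens'[OF trivial_limit_at_right_real] by blast
  \<comment> \<open>Half of the gain; the other half absorbs all lower-order factors, so the error
    function can be taken to be 0.\<close>
  define \<gamma> where "\<gamma> = (s ^ 3 / 6 * \<delta> - 25000 * s ^ 4 - s ^ 6 / L) / 2"
  have \<gamma>: "\<gamma> > 0" using s by (simp add: \<gamma>_def)
  \<comment> \<open>Growth rate of the number of vertices. The coefficient 12289, one more than in
    the clique bound, leaves a factor \<open>exp (- (s ^ 4 * t ^ 2))\<close> that makes the expected
    number of cliques vanish.\<close>
  define a where "a = a0 + s ^ 3 / 6 - 12289 * s ^ 4"
  have a: "a > 0"
  proof -
    have "s ^ 3 / 6 * \<delta> \<le> s ^ 3 / 6 * 1" using \<delta>1 s by (intro mult_left_mono) auto
    moreover have "s ^ 6 / L \<ge> 0" "s ^ 4 \<ge> 0" using s L by auto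
    ultimately show ?thesis using s(2) a0 unfolding a_def by linarith
  qed
  have ev1: "\<forall>\<^sub>F t in at_top. exp (a0 * real t + s ^ 3 * (3 * real t - 2) / 6 - s ^ 4 * real t ^ 2) < 1 / 2"
    using s a0 by real_asymp
  have ev2: "\<forall>\<^sub>F t in at_top. ln 2 + ln (real t + 1) + real t * ln (real t) + real t * ln 2 + real t * L / 2 \<le> \<gamma> * real t ^ 2"
    using \<gamma> L by real_asymp
  have "\<forall>\<^sub>F t in at_top. c_const t t \<le> exp ((f - \<gamma>) * real t ^ 2)"
    using ev1 ev2 eventually_gt_at_top[of 0]
  proof eventually_elim
    case (elim t)
    have tpos: "real t > 0" using elim by simp
    define n where "n = nat \<lfloor>exp (a * real t)\<rfloor>"
    have e1: "exp (a * real t) \<ge> 1" using a by simp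
    have fl: "1 \<le> \<lfloor>exp (a * real t)\<rfloor>" using e1 by (simp add: le_floor_iff)
    have n1: "1 \<le> n" using fl unfolding n_def by linarith
    have nreal: "real n = of_int \<lfloor>exp (a * real t)\<rfloor>" using fl unfolding n_def by (intro of_nat_nat) linarith
    have n_up: "real n \<le> exp (a * real t)" unfolding nreal by (rule of_int_floor_le)
    \<comment> \<open>Rounding down at most halves the number of vertices, which costs only
      \<open>2 ^ t\<close> in the end.\<close>
    have n_lo: "exp (a * real t) / 2 \<le> real n"
    proof -
      have "exp (a * real t) < real n + 1" unfolding nreal by linarith
      moreover have "1 \<le> real n" using n1 by simp
      ultimately show ?thesis by simp
    qed
    define W where "W x y = kernel p q s (1 / real t * dot x y)" for x y
    define M where "M = exp (real t ^ 2 * (f - 2 * \<gamma> + a) + real t * L / 2)"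
    have pow_up: "real n ^ k \<le> exp (real k * (a * real t))" for k
      using power_mono[OF n_up, of k] by (simp add: exp_of_nat_mult)
    have W: "0 \<le> W x y" "W x y \<le> 1" for x y
      using kernel_pos[OF p(1), of q s] kernel_le[OF p(1), of q s] p q
      by (auto simp: W_def intro: less_imp_le order_trans[of _ q])
    obtain E where E: "simple_graph E" "\<not> contains_clique n E t"
      "indep_prob n E t \<le> 2 * (real t + 1) * real t ^ t * M / real n ^ t"
    proof (rule random_kernel_graph[of "cube (t ^ 2)" W n t t M])
      have "real n ^ t * pair_avg (cube (t ^ 2)) W t \<le> exp (real t * (a * real t)) *
          exp (real t * (real t - 1) / 2 * ln p - s ^ 3 * ((real t - 1) * (real t - 2) / 6) + 12288 * s ^ 4 * real t ^ 2)"
        unfolding W_def using p s elim W(1)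
        by (intro mult_mono pow_up pair_avg_kernel_clique pair_avg_nonneg) (auto simp: W_def)
      also have "\<dots> = exp (a0 * real t + s ^ 3 * (3 * real t - 2) / 6 - s ^ 4 * real t ^ 2)"
        unfolding exp_add[symmetric] by (simp add: a_def a0_def field_simps power2_eq_square)
      finally show "real n ^ t * pair_avg (cube (t ^ 2)) W t < 1 / 2" using elim(1) by linarith
    next
      fix k assume k: "k \<le> t"
      define y where "y = real k / real t"
      have y: "0 \<le> y" "y \<le> 1" using k tpos by (auto simp: y_def)
      have kt: "real k = y * real t" using tpos by (simp add: y_def)
      have "real n ^ k * pair_avg (cube (t ^ 2)) (\<lambda>x y. 1 - W x y) k \<le> exp (real k * (a * real t)) *
          exp (real k * (real k - 1) / 2 * (ln (1 - p) + 2 * s ^ 4)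
            + real t ^ 2 * ((s * \<rho> * (real k / real t)) ^ 3 / 6 + 12289 * s ^ 4))"
        unfolding W_def using p q s elim \<rho> \<rho>_eq k W(2)
        by (intro mult_mono pow_up pair_avg_kernel_indep pair_avg_nonneg) (auto simp: W_def \<eta>_def)
      \<comment> \<open>The error \<open>2 * s ^ 4\<close> per pair contributes at most
        \<open>s ^ 4 * t ^ 2\<close>, raising 12289 to 12290; the subtracted last term is the
        slack.\<close>
      also have "\<dots> = exp (real t ^ 2 * (a * y - L * y ^ 2 / 2 + (s * \<rho> * y) ^ 3 / 6 + 12290 * s ^ 4)
          + (real t * L / 2) * y - s ^ 4 * (real t ^ 2 * (1 - y ^ 2) + y * real t))"
        unfolding exp_add[symmetric] y_def[symmetric] kt
        by (simp add: L_def field_simps power2_eq_square)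
      also have "\<dots> \<le> M"
      proof -
        have "real t ^ 2 * (a * y - L * y ^ 2 / 2 + (s * \<rho> * y) ^ 3 / 6 + 12290 * s ^ 4) \<le> real t ^ 2 * (f - 2 * \<gamma> + a)"
        proof (rule mult_left_mono)
          have "2 * \<gamma> = s ^ 3 / 6 * (1 - \<kappa> - (\<kappa> * \<rho>) ^ 3) - 25000 * s ^ 4 - s ^ 6 / L"
            by (simp add: \<gamma>_def \<delta>_def)
          then show "a * y - L * y ^ 2 / 2 + (s * \<rho> * y) ^ 3 / 6 + 12290 * s ^ 4 \<le> f - 2 * \<gamma> + a"
            using exponent_le[OF L less_imp_le[OF a0] \<kappa>_def \<kappa>1 less_imp_le[OF \<rho>0] \<rho>(2) less_imp_le[OF s(3)] y]
            unfolding a_def f_def by linarith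
        qed simp
        moreover have "(real t * L / 2) * y \<le> real t * L / 2"
          using y L tpos by (intro mult_left_le) auto
        moreover have "0 \<le> s ^ 4 * (real t ^ 2 * (1 - y ^ 2) + y * real t)"
          using y power_le_one[OF y, of 2] tpos by auto
        ultimately show ?thesis by (simp add: M_def)
      qed
      finally show "real n ^ k * pair_avg (cube (t ^ 2)) (\<lambda>x y. 1 - W x y) k \<le> M" .
    next
      show "0 < M" by (simp add: M_def)
    qed (use W in auto)
    have "c_const t t \<le> indep_prob n E t" by (rule c_const_le[OF n1 E(1,2)])
    also note E(3)
    also have "2 * (real t + 1) * real t ^ t * M / real n ^ t \<le>
        2 * (real t + 1) * real t ^ t * M / (exp (a * real t) / 2) ^ t"
      using n_lo n1 by (intro divide_left_mono power_mono) (auto simp: M_def)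
    also have "\<dots> = exp (ln 2 + ln (real t + 1) + real t * ln (real t) + real t * ln 2 + real t * L / 2 + real t ^ 2 * (f - 2 * \<gamma>))"
    proof -
      have "real t ^ t = exp (real t * ln (real t))" "2 ^ t = exp (real t * ln 2)"
        using tpos by (simp_all add: exp_of_nat_mult)
      moreover have "(exp (a * real t) / 2) ^ t = exp (real t * (a * real t)) / 2 ^ t"
        by (simp add: power_divide exp_of_nat_mult)
      moreover have "M = exp (real t ^ 2 * (f - 2 * \<gamma>)) * exp (real t * (a * real t)) * exp (real t * L / 2)"
        unfolding M_def exp_add[symmetric] by (simp add: algebra_simps power2_eq_square)
      ultimately show ?thesis using tpos by (simp add: exp_add)
    qed
    also have "\<dots> \<le> exp (\<gamma> * real t ^ 2 + real t ^ 2 * (f - 2 * \<gamma>))"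
      using elim(2) by simp
    also have "\<dots> = exp ((f - \<gamma>) * real t ^ 2)" by (simp add: algebra_simps)
    finally show ?case .
  qed
  then show ?thesis
    using \<gamma> unfolding f_eq by (intro exI[of _ \<gamma>] conjI exI[of _ "\<lambda>_. 0"]) auto
qed

end
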